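(* Let $\mathbf{BM}_{\mathrm{gr}}\subset\mathbf{BM}$ denote the wide subcategory of the Borisov--Manin category of graphs with only graftings as morphisms, and let $\dot{\mathbf{Gr}}_{\mathrm{rc}}\subset\mathbf{Gr}$ denote the wide subcategory whose objects are the graphs without isolated edges, and whose morphisms are the reduced covers. There is a canonical equivalence $$\Phi_1:\mathbf{BM}_{\mathrm{gr}}\xrightarrow{\ \sim\ }\dot{\mathbf{Gr}}_{\mathrm{rc}}.$$
   Context: **The Borisov--Manin category $\mathbf{BM}$.** A BM graph is a quadruple $\tau=(V_\tau,F_\tau,\partial_\tau,j_\tau)$ with $V_\tau$ a set (of vertices), $F_\tau$ a set (of flags), $\partial_\tau:F_\tau\to V_\tau$ a map and $j_\tau:F_\tau\to F_\tau$ an involution. Fixed points of $j_\tau$ are called tails; two-element $j_\tau$-orbits are called edges. A morphism $h:\tau\to\sigma$ is a triple $(h^F,h_V,j_h)$ with $h^F:F_\sigma\to F_\tau$ a map, $h_V:V_\tau\to V_\sigma$ a map, and $j_h$ an involution on $F_\tau\setminus h^F(F_\sigma)$ such that: (i) $h^F$ is injective and $h_V$ is surjective; (ii) $h^F(F_\sigma)$ and its complement are $j_\tau$-invariant; (ii') $j_h$ is fixpoint free and agrees with $j_\tau$ on those flags of its domain that belong to edges of $\tau$; (iii) if $f_\tau=h^F(f_\sigma)$ then $h_V(\partial_\tau f_\tau)=\partial_\sigma f_\sigma$, and for every $f\in F_\tau\setminus h^F(F_\sigma)$ one has $h_V(\partial_\tau f)=h_V(\partial_\tau j_h(f))$; (iv)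 the bijection $(h^F)^{-1}:h^F(F_\sigma)\to F_\sigma$ maps edges of $\tau$ to edges of $\sigma$. The composite of $g:\tau\to\sigma$ and $c:\sigma\to\rho$ is $h=c\circ g$ with $h_V=c_V\circ g_V$, $h^F=g^F\circ c^F$, and $j_h$ equal to $j_g$ on $F_\tau\setminus g^F(F_\sigma)$ and to $j_c$ (transported along the injection $g^F$) on $g^F(F_\sigma\setminus c^F(F_\rho))$. A morphism $h$ is a grafting when both $h_V$ and $h^F$ are bijective. **The category $\mathbf{Gr}$ (Joyal--Kock graphs).** A graph in the sense of Joyal--Kock is a diagram of finite sets $A\xleftarrow{s}H\xrightarrow{p}V$ together with a fixpoint-free involution $i:A\to A$, with $s$ injective. $V$ is the set of vertices, $H$ the set of half-edges, $A$ the set of arcs. An edge is an $i$-orbit; it is isolated if neither of its arcs is in the image of $s$. An etale morphism of graphs is a triple of maps on $A,H,V$ commuting with $i,s,p$ and such that the square involving $p:H\to V$ is a pullback. $\mathbf{Gr}$ is the category of graphs and etale morphisms. A covering family of a graph $\mathsf X$ is a family of etale morphisms with codomain $\mathsf X$ that is jointly surjective on edges and vertices; it is reduced when no member can be omitted or replaced by a proper subgraph without spoiling the joint surjectivity. A reduced cover is the single etale morphism obtained from a reduced covering family by taking the sum (disjoint union) of the domains. In the absence of isolated edges, this means an etale morphism that is bijective on vertices.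
   Formalization: BM graphs are required to have finite sets of vertices and flags; with arbitrary sets the equivalence fails, since Joyal–Kock graphs are finite and have finite hom-sets. *)

theory Defs
  imports Main "HOL-Library.FuncSet"
begin

section \<open>Categories, functors, equivalences\<close>

text \<open>
  A category is given by its hom-sets, which need not be disjoint: a morphism is always considered
  together with its domain and codomain. Thus \<open>cmp C X Y Z g f\<close> is the composite
  \<open>g \<circ> f\<close> of \<open>f : X \<rightarrow> Y\<close> and \<open>g : Y \<rightarrow> Z\<close>, and the action of a functor on morphisms
  takes the domain and codomain as arguments.
\<close>

record ('o, 'm) cat =
  ob  :: "'o set"
  hom :: "'o \<Rightarrow> 'o \<Rightarrow> 'm set"
  idm :: "'o \<Rightarrow> 'm"
  cmp :: "'o \<Rightarrow> 'o \<Rightarrow> 'o \<Rightarrow> 'm \<Rightarrow> 'm \<Rightarrow> 'm"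

locale category =
  fixes C :: "('o, 'm) cat"
  assumes idm_hom: "X \<in> ob C \<Longrightarrow> idm C X \<in> hom C X X"
    and cmp_hom: "\<lbrakk>X \<in> ob C; Y \<in> ob C; Z \<in> ob C; f \<in> hom C X Y; g \<in> hom C Y Z\<rbrakk>
      \<Longrightarrow> cmp C X Y Z g f \<in> hom C X Z"
    and cmp_idm: "\<lbrakk>X \<in> ob C; Y \<in> ob C; f \<in> hom C X Y\<rbrakk> \<Longrightarrow> cmp C X X Y f (idm C X) = f"
    and idm_cmp: "\<lbrakk>X \<in> ob C; Y \<in> ob C; f \<in> hom C X Y\<rbrakk> \<Longrightarrow> cmp C X Y Y (idm C Y) f = f"
    and cmp_assoc: "\<lbrakk>W \<in> ob C; X \<in> ob C; Y \<in> ob C; Z \<in> ob C;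
        f \<in> hom C W X; g \<in> hom C X Y; h \<in> hom C Y Z\<rbrakk>
      \<Longrightarrow> cmp C W X Z (cmp C X Y Z h g) f = cmp C W Y Z h (cmp C W X Y g f)"

definition subcat :: "('o, 'm) cat \<Rightarrow> ('o \<Rightarrow> bool) \<Rightarrow> ('o \<Rightarrow> 'o \<Rightarrow> 'm \<Rightarrow> bool) \<Rightarrow> ('o, 'm) cat" where
  "subcat C P Q = C\<lparr>ob := {X \<in> ob C. P X}, hom := (\<lambda>X Y. {f \<in> hom C X Y. Q X Y f})\<rparr>"

definition iso_in :: "('o, 'm) cat \<Rightarrow> 'o \<Rightarrow> 'o \<Rightarrow> 'm \<Rightarrow> bool" where
  "iso_in C X Y f \<longleftrightarrow> f \<in> hom C X Y \<and>
     (\<exists>g \<in> hom C Y X. cmp C X Y X g f = idm C X \<and> cmp C Y X Y f g = idm C Y)"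

locale functor_between = C: category C + D: category D
  for C :: "('o, 'm) cat" and D :: "('p, 'n) cat" +
  fixes Fo :: "'o \<Rightarrow> 'p" and Fm :: "'o \<Rightarrow> 'o \<Rightarrow> 'm \<Rightarrow> 'n"
  assumes functor_ob: "X \<in> ob C \<Longrightarrow> Fo X \<in> ob D"
    and functor_hom: "\<lbrakk>X \<in> ob C; Y \<in> ob C; f \<in> hom C X Y\<rbrakk> \<Longrightarrow> Fm X Y f \<in> hom D (Fo X) (Fo Y)"
    and functor_idm: "X \<in> ob C \<Longrightarrow> Fm X X (idm C X) = idm D (Fo X)"
    and functor_cmp: "\<lbrakk>X \<in> ob C; Y \<in> ob C; Z \<in> ob C; f \<in> hom C X Y; g \<in> hom C Y Z\<rbrakk>
      \<Longrightarrow> Fm X Z (cmp C X Y Z g f) = cmp D (Fo X) (Fo Y) (Fo Z) (Fm Y Z g) (Fm X Y f)"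

definition natural_iso ::
  "('o, 'm) cat \<Rightarrow> ('p, 'n) cat \<Rightarrow> ('o \<Rightarrow> 'p) \<Rightarrow> ('o \<Rightarrow> 'o \<Rightarrow> 'm \<Rightarrow> 'n) \<Rightarrow>
   ('o \<Rightarrow> 'p) \<Rightarrow> ('o \<Rightarrow> 'o \<Rightarrow> 'm \<Rightarrow> 'n) \<Rightarrow> ('o \<Rightarrow> 'n) \<Rightarrow> bool" where
  "natural_iso C D Fo Fm Go Gm \<eta> \<longleftrightarrow>
     functor_between C D Fo Fm \<and> functor_between C D Go Gm \<and>
     (\<forall>X \<in> ob C. iso_in D (Fo X) (Go X) (\<eta> X)) \<and>
     (\<forall>X \<in> ob C. \<forall>Y \<in> ob C. \<forall>f \<in> hom C X Y.
        cmp D (Fo X) (Go X) (Go Y) (Gm X Y f) (\<eta> X) = cmp D (Fo X) (Fo Y) (Go Y) (\<eta> Y) (Fm X Y f))"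

definition equivalence_of_categories ::
  "('o, 'm) cat \<Rightarrow> ('p, 'n) cat \<Rightarrow> ('o \<Rightarrow> 'p) \<Rightarrow> ('o \<Rightarrow> 'o \<Rightarrow> 'm \<Rightarrow> 'n) \<Rightarrow> bool" where
  "equivalence_of_categories C D Fo Fm \<longleftrightarrow>
     functor_between C D Fo Fm \<and>
     (\<exists>Go Gm \<eta> \<epsilon>.
        functor_between D C Go Gm \<and>
        natural_iso C C (\<lambda>X. X) (\<lambda>X Y f. f) (\<lambda>X. Go (Fo X)) (\<lambda>X Y f. Gm (Fo X) (Fo Y) (Fm X Y f)) \<eta> \<and>
        natural_iso D D (\<lambda>X. Fo (Go X)) (\<lambda>X Y f. Fm (Go X) (Go Y) (Gm X Y f)) (\<lambda>X. X) (\<lambda>X Y f. f) \<epsilon>)"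


section \<open>The Borisov--Manin category\<close>

text \<open>
  Here and below, maps between carrier sets are required to be extensional (\<open>\<rightarrow>\<^sub>E\<close>), so that equality
  of graphs and of morphisms is equality of the underlying mathematical data. Graphs are finite. The
  flag map of a morphism of BM graphs is contravariant, and its last component is an involution of
  the flags outside the image of the flag map.
\<close>

record ('f, 'v) bm_graph =
  bm_verts :: "'v set"
  bm_flags :: "'f set"
  bm_bdry  :: "'f \<Rightarrow> 'v"
  bm_inv   :: "'f \<Rightarrow> 'f"

definition is_bm_graph :: "('f, 'v) bm_graph \<Rightarrow> bool" where
  "is_bm_graph \<tau> \<longleftrightarrow> finite (bm_verts \<tau>) \<and> finite (bm_flags \<tau>) \<and>
     bm_bdry \<tau> \<in> bm_flags \<tau> \<rightarrow>\<^sub>E bm_verts \<tau> \<and>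
     bm_inv \<tau> \<in> bm_flags \<tau> \<rightarrow>\<^sub>E bm_flags \<tau> \<and>
     (\<forall>f \<in> bm_flags \<tau>. bm_inv \<tau> (bm_inv \<tau> f) = f)"

definition bm_tails :: "('f, 'v) bm_graph \<Rightarrow> 'f set" where
  "bm_tails \<tau> = {f \<in> bm_flags \<tau>. bm_inv \<tau> f = f}"

definition bm_edges :: "('f, 'v) bm_graph \<Rightarrow> 'f set set" where
  "bm_edges \<tau> = {{f, bm_inv \<tau> f} | f. f \<in> bm_flags \<tau> \<and> bm_inv \<tau> f \<noteq> f}"

record ('f, 'v) bm_mor =
  bm_mor_flag :: "'f \<Rightarrow> 'f"
  bm_mor_vert :: "'v \<Rightarrow> 'v"
  bm_mor_inv  :: "'f \<Rightarrow> 'f"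

definition bm_lost_flags :: "('f, 'v) bm_graph \<Rightarrow> ('f, 'v) bm_graph \<Rightarrow> ('f, 'v) bm_mor \<Rightarrow> 'f set" where
  "bm_lost_flags \<tau> \<sigma> h = bm_flags \<tau> - bm_mor_flag h ` bm_flags \<sigma>"

definition bm_hom :: "('f, 'v) bm_graph \<Rightarrow> ('f, 'v) bm_graph \<Rightarrow> ('f, 'v) bm_mor set" where
  "bm_hom \<tau> \<sigma> = {h.
     bm_mor_flag h \<in> bm_flags \<sigma> \<rightarrow>\<^sub>E bm_flags \<tau> \<and>
     bm_mor_vert h \<in> bm_verts \<tau> \<rightarrow>\<^sub>E bm_verts \<sigma> \<and>
     bm_mor_inv h \<in> bm_lost_flags \<tau> \<sigma> h \<rightarrow>\<^sub>E bm_lost_flags \<tau> \<sigma> h \<and>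
     (\<forall>f \<in> bm_lost_flags \<tau> \<sigma> h. bm_mor_inv h (bm_mor_inv h f) = f) \<and>
     inj_on (bm_mor_flag h) (bm_flags \<sigma>) \<and>
     bm_mor_vert h ` bm_verts \<tau> = bm_verts \<sigma> \<and>
     bm_inv \<tau> ` (bm_mor_flag h ` bm_flags \<sigma>) \<subseteq> bm_mor_flag h ` bm_flags \<sigma> \<and>
     bm_inv \<tau> ` bm_lost_flags \<tau> \<sigma> h \<subseteq> bm_lost_flags \<tau> \<sigma> h \<and>
     (\<forall>f \<in> bm_lost_flags \<tau> \<sigma> h. bm_mor_inv h f \<noteq> f) \<and>
     (\<forall>f \<in> bm_lost_flags \<tau> \<sigma> h. f \<in> \<Union> (bm_edges \<tau>) \<longrightarrow> bm_mor_inv h f = bm_inv \<tau> f) \<and>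
     (\<forall>f \<in> bm_flags \<sigma>. bm_mor_vert h (bm_bdry \<tau> (bm_mor_flag h f)) = bm_bdry \<sigma> f) \<and>
     (\<forall>f \<in> bm_lost_flags \<tau> \<sigma> h.
        bm_mor_vert h (bm_bdry \<tau> f) = bm_mor_vert h (bm_bdry \<tau> (bm_mor_inv h f))) \<and>
     (\<forall>e \<in> bm_edges \<tau>. e \<subseteq> bm_mor_flag h ` bm_flags \<sigma> \<longrightarrow>
        inv_into (bm_flags \<sigma>) (bm_mor_flag h) ` e \<in> bm_edges \<sigma>)}"

definition bm_id :: "('f, 'v) bm_graph \<Rightarrow> ('f, 'v) bm_mor" where
  "bm_id \<tau> = \<lparr>bm_mor_flag = (\<lambda>f \<in> bm_flags \<tau>. f), bm_mor_vert = (\<lambda>v \<in> bm_verts \<tau>. v),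
              bm_mor_inv = (\<lambda>_. undefined)\<rparr>"

definition bm_comp ::
  "('f, 'v) bm_graph \<Rightarrow> ('f, 'v) bm_graph \<Rightarrow> ('f, 'v) bm_graph \<Rightarrow>
   ('f, 'v) bm_mor \<Rightarrow> ('f, 'v) bm_mor \<Rightarrow> ('f, 'v) bm_mor" where
  "bm_comp \<tau> \<sigma> \<rho> c g =
     \<lparr>bm_mor_flag = compose (bm_flags \<rho>) (bm_mor_flag g) (bm_mor_flag c),
      bm_mor_vert = compose (bm_verts \<tau>) (bm_mor_vert c) (bm_mor_vert g),
      bm_mor_inv = (\<lambda>f \<in> bm_flags \<tau> - bm_mor_flag g ` bm_mor_flag c ` bm_flags \<rho>.
        if f \<in> bm_lost_flags \<tau> \<sigma> g then bm_mor_inv g f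
        else bm_mor_flag g (bm_mor_inv c (inv_into (bm_flags \<sigma>) (bm_mor_flag g) f)))\<rparr>"

definition BM :: "(('f, 'v) bm_graph, ('f, 'v) bm_mor) cat" where
  "BM = \<lparr>ob = {\<tau>. is_bm_graph \<tau>}, hom = bm_hom, idm = bm_id, cmp = bm_comp\<rparr>"

definition is_grafting :: "('f, 'v) bm_graph \<Rightarrow> ('f, 'v) bm_graph \<Rightarrow> ('f, 'v) bm_mor \<Rightarrow> bool" where
  "is_grafting \<tau> \<sigma> h \<longleftrightarrow>
     bij_betw (bm_mor_vert h) (bm_verts \<tau>) (bm_verts \<sigma>) \<and>
     bij_betw (bm_mor_flag h) (bm_flags \<sigma>) (bm_flags \<tau>)"

definition BM_gr :: "(('f, 'v) bm_graph, ('f, 'v) bm_mor) cat" where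
  "BM_gr = subcat BM (\<lambda>\<tau>. True) is_grafting"


section \<open>Joyal--Kock graphs and etale morphisms\<close>

record ('a, 'h, 'v) jk_graph =
  jk_arcs  :: "'a set"
  jk_half  :: "'h set"
  jk_verts :: "'v set"
  jk_s :: "'h \<Rightarrow> 'a"
  jk_p :: "'h \<Rightarrow> 'v"
  jk_i :: "'a \<Rightarrow> 'a"

definition is_jk_graph :: "('a, 'h, 'v) jk_graph \<Rightarrow> bool" where
  "is_jk_graph X \<longleftrightarrow> finite (jk_arcs X) \<and> finite (jk_half X) \<and> finite (jk_verts X) \<and>
     jk_s X \<in> jk_half X \<rightarrow>\<^sub>E jk_arcs X \<and> inj_on (jk_s X) (jk_half X) \<and>
     jk_p X \<in> jk_half X \<rightarrow>\<^sub>E jk_verts X \<and>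
     jk_i X \<in> jk_arcs X \<rightarrow>\<^sub>E jk_arcs X \<and>
     (\<forall>a \<in> jk_arcs X. jk_i X (jk_i X a) = a \<and> jk_i X a \<noteq> a)"

definition jk_edges :: "('a, 'h, 'v) jk_graph \<Rightarrow> 'a set set" where
  "jk_edges X = {{a, jk_i X a} | a. a \<in> jk_arcs X}"

definition isolated_edge :: "('a, 'h, 'v) jk_graph \<Rightarrow> 'a set \<Rightarrow> bool" where
  "isolated_edge X e \<longleftrightarrow> e \<in> jk_edges X \<and> e \<inter> jk_s X ` jk_half X = {}"

record ('a, 'h, 'v) jk_mor =
  jk_mor_arc  :: "'a \<Rightarrow> 'a"
  jk_mor_half :: "'h \<Rightarrow> 'h"
  jk_mor_vert :: "'v \<Rightarrow> 'v"

text \<open>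
  The last condition says that the square formed by \<open>p\<close> and the maps on half-edges and vertices is
  a pullback: the comparison map into the fibre product is bijective.
\<close>

definition etale_hom :: "('a, 'h, 'v) jk_graph \<Rightarrow> ('a, 'h, 'v) jk_graph \<Rightarrow> ('a, 'h, 'v) jk_mor set" where
  "etale_hom X Y = {f.
     jk_mor_arc f \<in> jk_arcs X \<rightarrow>\<^sub>E jk_arcs Y \<and>
     jk_mor_half f \<in> jk_half X \<rightarrow>\<^sub>E jk_half Y \<and>
     jk_mor_vert f \<in> jk_verts X \<rightarrow>\<^sub>E jk_verts Y \<and>
     (\<forall>a \<in> jk_arcs X. jk_mor_arc f (jk_i X a) = jk_i Y (jk_mor_arc f a)) \<and>
     (\<forall>h \<in> jk_half X. jk_mor_arc f (jk_s X h) = jk_s Y (jk_mor_half f h)) \<and>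
     (\<forall>h \<in> jk_half X. jk_mor_vert f (jk_p X h) = jk_p Y (jk_mor_half f h)) \<and>
     bij_betw (\<lambda>h. (jk_p X h, jk_mor_half f h)) (jk_half X)
       {(v, k) \<in> jk_verts X \<times> jk_half Y. jk_mor_vert f v = jk_p Y k}}"

definition jk_id :: "('a, 'h, 'v) jk_graph \<Rightarrow> ('a, 'h, 'v) jk_mor" where
  "jk_id X = \<lparr>jk_mor_arc = (\<lambda>a \<in> jk_arcs X. a), jk_mor_half = (\<lambda>h \<in> jk_half X. h),
              jk_mor_vert = (\<lambda>v \<in> jk_verts X. v)\<rparr>"

definition jk_comp ::
  "('a, 'h, 'v) jk_graph \<Rightarrow> ('a, 'h, 'v) jk_graph \<Rightarrow> ('a, 'h, 'v) jk_graph \<Rightarrow>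
   ('a, 'h, 'v) jk_mor \<Rightarrow> ('a, 'h, 'v) jk_mor \<Rightarrow> ('a, 'h, 'v) jk_mor" where
  "jk_comp X Y Z g f =
     \<lparr>jk_mor_arc = compose (jk_arcs X) (jk_mor_arc g) (jk_mor_arc f),
      jk_mor_half = compose (jk_half X) (jk_mor_half g) (jk_mor_half f),
      jk_mor_vert = compose (jk_verts X) (jk_mor_vert g) (jk_mor_vert f)\<rparr>"

definition Gr :: "(('a, 'h, 'v) jk_graph, ('a, 'h, 'v) jk_mor) cat" where
  "Gr = \<lparr>ob = {X. is_jk_graph X}, hom = etale_hom, idm = jk_id, cmp = jk_comp\<rparr>"


section \<open>Reduced covers\<close>

text \<open>
  Subgraphs are those whose inclusion is etale, since replacing a member of a covering family by a
  subgraph has to yield a family of etale morphisms again.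
\<close>

definition subgraph :: "('a, 'h, 'v) jk_graph \<Rightarrow> ('a, 'h, 'v) jk_graph \<Rightarrow> bool" where
  "subgraph Z Y \<longleftrightarrow> is_jk_graph Z \<and> jk_id Z \<in> etale_hom Z Y"

definition covering_family ::
  "('a, 'h, 'v) jk_graph \<Rightarrow> 'k set \<Rightarrow> ('k \<Rightarrow> ('a, 'h, 'v) jk_graph) \<Rightarrow> ('k \<Rightarrow> ('a, 'h, 'v) jk_mor) \<Rightarrow> bool" where
  "covering_family X K D f \<longleftrightarrow>
     (\<forall>k \<in> K. is_jk_graph (D k) \<and> f k \<in> etale_hom (D k) X) \<and>
     (\<Union>k \<in> K. (\<lambda>e. jk_mor_arc (f k) ` e) ` jk_edges (D k)) = jk_edges X \<and>
     (\<Union>k \<in> K. jk_mor_vert (f k) ` jk_verts (D k)) = jk_verts X"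

definition reduced_covering_family ::
  "('a, 'h, 'v) jk_graph \<Rightarrow> 'k set \<Rightarrow> ('k \<Rightarrow> ('a, 'h, 'v) jk_graph) \<Rightarrow> ('k \<Rightarrow> ('a, 'h, 'v) jk_mor) \<Rightarrow> bool" where
  "reduced_covering_family X K D f \<longleftrightarrow>
     covering_family X K D f \<and>
     (\<forall>k \<in> K. \<not> covering_family X (K - {k}) D f) \<and>
     (\<forall>k \<in> K. \<forall>Z. subgraph Z (D k) \<and> Z \<noteq> D k \<longrightarrow>
        \<not> covering_family X K (D(k := Z)) (f(k := jk_comp Z (D k) X (f k) (jk_id Z))))"

definition is_sum ::
  "'k set \<Rightarrow> ('k \<Rightarrow> ('a, 'h, 'v) jk_graph) \<Rightarrow> ('k \<Rightarrow> ('a, 'h, 'v) jk_mor) \<Rightarrow> ('a, 'h, 'v) jk_graph \<Rightarrow> bool" where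
  "is_sum K D \<iota> Y \<longleftrightarrow> is_jk_graph Y \<and>
     (\<forall>k \<in> K. is_jk_graph (D k) \<and> \<iota> k \<in> etale_hom (D k) Y) \<and>
     bij_betw (\<lambda>(k, a). jk_mor_arc (\<iota> k) a) (SIGMA k:K. jk_arcs (D k)) (jk_arcs Y) \<and>
     bij_betw (\<lambda>(k, h). jk_mor_half (\<iota> k) h) (SIGMA k:K. jk_half (D k)) (jk_half Y) \<and>
     bij_betw (\<lambda>(k, v). jk_mor_vert (\<iota> k) v) (SIGMA k:K. jk_verts (D k)) (jk_verts Y)"

text \<open>
  Natural numbers suffice as indices: each member of a reduced covering family is needed to hit some
  edge or vertex of the finite graph \<open>X\<close>, so the family is finite. The index set may be empty.
\<close>

definition reduced_cover ::
  "('a, 'h, 'v) jk_graph \<Rightarrow> ('a, 'h, 'v) jk_graph \<Rightarrow> ('a, 'h, 'v) jk_mor \<Rightarrow> bool" where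
  "reduced_cover Y X f \<longleftrightarrow> f \<in> etale_hom Y X \<and>
     (\<exists>(K :: nat set) D fam \<iota>. reduced_covering_family X K D fam \<and> is_sum K D \<iota> Y \<and>
        (\<forall>k \<in> K. jk_comp (D k) Y X f (\<iota> k) = fam k))"

definition Gr_rc :: "(('a, 'h, 'v) jk_graph, ('a, 'h, 'v) jk_mor) cat" where
  "Gr_rc = subcat Gr (\<lambda>X. \<nexists>e. isolated_edge X e) reduced_cover"


section \<open>The comparison functor\<close>

text \<open>
  Vertices and half-edges are the vertices and flags of the BM graph. Each flag \<open>f\<close> gives an arc
  \<open>Inl f\<close>, and each tail \<open>f\<close> gives a further arc \<open>Inr f\<close>, the opposite of \<open>Inl f\<close>. On morphisms the
  contravariant flag bijection of a grafting is inverted; the value on \<open>Inr f\<close> is then forced by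
  compatibility with the involutions.
\<close>

definition Phi1_ob :: "('f, 'v) bm_graph \<Rightarrow> ('f + 'f, 'f, 'v) jk_graph" where
  "Phi1_ob \<tau> =
     \<lparr>jk_arcs = bm_flags \<tau> <+> bm_tails \<tau>,
      jk_half = bm_flags \<tau>,
      jk_verts = bm_verts \<tau>,
      jk_s = (\<lambda>f \<in> bm_flags \<tau>. Inl f),
      jk_p = bm_bdry \<tau>,
      jk_i = (\<lambda>a \<in> bm_flags \<tau> <+> bm_tails \<tau>.
        case a of Inl f \<Rightarrow> if f \<in> bm_tails \<tau> then Inr f else Inl (bm_inv \<tau> f) | Inr f \<Rightarrow> Inl f)\<rparr>"

definition Phi1_mor ::
  "('f, 'v) bm_graph \<Rightarrow> ('f, 'v) bm_graph \<Rightarrow> ('f, 'v) bm_mor \<Rightarrow> ('f + 'f, 'f, 'v) jk_mor" where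
  "Phi1_mor \<tau> \<sigma> h =
     (let g = inv_into (bm_flags \<sigma>) (bm_mor_flag h) in
     \<lparr>jk_mor_arc = (\<lambda>a \<in> bm_flags \<tau> <+> bm_tails \<tau>.
        case a of Inl f \<Rightarrow> Inl (g f) | Inr f \<Rightarrow> jk_i (Phi1_ob \<sigma>) (Inl (g f))),
      jk_mor_half = (\<lambda>f \<in> bm_flags \<tau>. g f),
      jk_mor_vert = bm_mor_vert h\<rparr>)"

end

theory Submission
  imports Defs
begin

text \<open>
  Deleting a vertex and its half-edges, but no arcs, leaves an etale subgraph with the same edges.
  Hence a reduced cover is injective on vertices, as otherwise one of two vertices with the same image
  could be deleted. Conversely, if there are no isolated edges, everything is determined by what
  happens at the vertices: an etale vertex bijection is bijective on half-edges by the pullback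
  condition, and half-edges and their opposites exhaust the arcs. So reduced covers \<open>X \<rightarrow> Y\<close> are the
  pairs of bijections on half-edges and on vertices such that two half-edges forming an edge of \<open>X\<close>
  are sent to two half-edges forming an edge of \<open>Y\<close>. Up to inverting the flag map, these are the
  graftings, with tails corresponding to edges having one open end. The quasi-inverse of \<open>\<Phi>\<^sub>1\<close> forgets
  the arcs outside the image of \<open>s\<close>.
\<close>

section \<open>Etale morphisms\<close>

lemma bij_betw_iff_ex1:
  assumes "f ` A \<subseteq> B"
  shows "bij_betw f A B \<longleftrightarrow> (\<forall>y \<in> B. \<exists>!x. x \<in> A \<and> f x = y)"
proof
  assume "bij_betw f A B"
  then show "\<forall>y \<in> B. \<exists>!x. x \<in> A \<and> f x = y"
    unfolding bij_betw_def inj_on_def by blast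
next
  assume "\<forall>y \<in> B. \<exists>!x. x \<in> A \<and> f x = y"
  then have "inj_on f A" "B \<subseteq> f ` A"
    using assms unfolding inj_on_def by blast+
  then show "bij_betw f A B" using assms by (simp add: bij_betw_def)
qed

text \<open>The pullback condition read one fibre at a time: the half-edges at a vertex
  \<open>v\<close> correspond one to one to those at its image. Etaleness is applied and verified in
  this local form throughout.\<close>

lemma etale_hom_iff:
  assumes "is_jk_graph X" "is_jk_graph Y"
  shows "f \<in> etale_hom X Y \<longleftrightarrow>
     jk_mor_arc f \<in> jk_arcs X \<rightarrow>\<^sub>E jk_arcs Y \<and>
     jk_mor_half f \<in> jk_half X \<rightarrow>\<^sub>E jk_half Y \<and>
     jk_mor_vert f \<in> jk_verts X \<rightarrow>\<^sub>E jk_verts Y \<and>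
     (\<forall>a \<in> jk_arcs X. jk_mor_arc f (jk_i X a) = jk_i Y (jk_mor_arc f a)) \<and>
     (\<forall>h \<in> jk_half X. jk_mor_arc f (jk_s X h) = jk_s Y (jk_mor_half f h)) \<and>
     (\<forall>h \<in> jk_half X. jk_mor_vert f (jk_p X h) = jk_p Y (jk_mor_half f h)) \<and>
     (\<forall>v \<in> jk_verts X. \<forall>k \<in> jk_half Y. jk_mor_vert f v = jk_p Y k \<longrightarrow>
        (\<exists>!h. h \<in> jk_half X \<and> jk_p X h = v \<and> jk_mor_half f h = k))"
    (is "?L \<longleftrightarrow> ?R")
proof -
  let ?P = "{(v, k) \<in> jk_verts X \<times> jk_half Y. jk_mor_vert f v = jk_p Y k}"
  let ?c = "\<lambda>h. (jk_p X h, jk_mor_half f h)"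
  have p: "jk_p X h \<in> jk_verts X" if "h \<in> jk_half X" for h
    using assms that by (auto simp: is_jk_graph_def)
  have pullback: "bij_betw ?c (jk_half X) ?P \<longleftrightarrow>
      (\<forall>v \<in> jk_verts X. \<forall>k \<in> jk_half Y. jk_mor_vert f v = jk_p Y k \<longrightarrow>
        (\<exists>!h. h \<in> jk_half X \<and> jk_p X h = v \<and> jk_mor_half f h = k))"
    if "jk_mor_half f \<in> jk_half X \<rightarrow>\<^sub>E jk_half Y"
      "\<forall>h \<in> jk_half X. jk_mor_vert f (jk_p X h) = jk_p Y (jk_mor_half f h)"
  proof -
    have "?c ` jk_half X \<subseteq> ?P"
      using that p by auto
    then have "bij_betw ?c (jk_half X) ?P \<longleftrightarrow> (\<forall>y \<in> ?P. \<exists>!h. h \<in> jk_half X \<and> ?c h = y)"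
      by (rule bij_betw_iff_ex1)
    then show ?thesis by (simp, blast)
  qed
  show ?thesis
    unfolding etale_hom_def mem_Collect_eq
    \<comment> \<open>The pullback clause is rewritten under the preceding clauses, because the
      comparison map lands in the fibre product only when these hold.\<close>
    by (intro conj_cong refl) (rule pullback; assumption)
qed

lemma jk_comp_sel [simp]:
  "jk_mor_arc (jk_comp X Y Z g f) = compose (jk_arcs X) (jk_mor_arc g) (jk_mor_arc f)"
  "jk_mor_half (jk_comp X Y Z g f) = compose (jk_half X) (jk_mor_half g) (jk_mor_half f)"
  "jk_mor_vert (jk_comp X Y Z g f) = compose (jk_verts X) (jk_mor_vert g) (jk_mor_vert f)"
  by (simp_all add: jk_comp_def)

lemma jk_id_sel [simp]:
  "jk_mor_arc (jk_id X) = (\<lambda>a \<in> jk_arcs X. a)"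
  "jk_mor_half (jk_id X) = (\<lambda>h \<in> jk_half X. h)"
  "jk_mor_vert (jk_id X) = (\<lambda>v \<in> jk_verts X. v)"
  by (simp_all add: jk_id_def)

lemma jk_id_etale:
  assumes "is_jk_graph X"
  shows "jk_id X \<in> etale_hom X X"
  using assms unfolding etale_hom_iff[OF assms assms]
  by (auto simp: is_jk_graph_def)

text \<open>Pullback squares paste: a half-edge \<open>k\<close> at the image of \<open>v\<close>
  under the composite lifts uniquely to a half-edge \<open>l\<close> at the image of
  \<open>v\<close> in \<open>Y\<close>, and \<open>l\<close> lifts uniquely to a half-edge at
  \<open>v\<close>.\<close>

lemma jk_comp_etale:
  assumes X: "is_jk_graph X" and Y: "is_jk_graph Y" and Z: "is_jk_graph Z"
    and f: "f \<in> etale_hom X Y" and g: "g \<in> etale_hom Y Z"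
  shows "jk_comp X Y Z g f \<in> etale_hom X Z"
proof -
  note f' = f[unfolded etale_hom_iff[OF X Y]] and g' = g[unfolded etale_hom_iff[OF Y Z]]
  have i: "jk_i X a \<in> jk_arcs X" if "a \<in> jk_arcs X" for a
    using X that by (auto simp: is_jk_graph_def)
  have s: "jk_s X h \<in> jk_arcs X" "jk_p X h \<in> jk_verts X" if "h \<in> jk_half X" for h
    using X that by (auto simp: is_jk_graph_def)
  have fA: "jk_mor_arc f a \<in> jk_arcs Y" if "a \<in> jk_arcs X" for a
    using f' that by auto
  have fH: "jk_mor_half f h \<in> jk_half Y" if "h \<in> jk_half X" for h
    using f' that by auto
  have fV: "jk_mor_vert f v \<in> jk_verts Y" if "v \<in> jk_verts X" for v
    using f' that by auto
  have "\<exists>!h. h \<in> jk_half X \<and> jk_p X h = v \<and> jk_mor_half g (jk_mor_half f h) = k"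
    if v: "v \<in> jk_verts X" and k: "k \<in> jk_half Z"
      and eq: "jk_mor_vert g (jk_mor_vert f v) = jk_p Z k" for v k
  proof -
    have "\<exists>!l. l \<in> jk_half Y \<and> jk_p Y l = jk_mor_vert f v \<and> jk_mor_half g l = k"
      using g' fV[OF v] k eq by blast
    then obtain l where l: "l \<in> jk_half Y" "jk_p Y l = jk_mor_vert f v" "jk_mor_half g l = k"
      and l_uniq: "\<And>l'. l' \<in> jk_half Y \<Longrightarrow> jk_p Y l' = jk_mor_vert f v \<Longrightarrow> jk_mor_half g l' = k \<Longrightarrow> l' = l"
      by blast
    have "\<exists>!h. h \<in> jk_half X \<and> jk_p X h = v \<and> jk_mor_half f h = l"
      using f' v l by metis
    \<comment> \<open>Every lift of \<open>k\<close> to \<open>v\<close> passes through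
      \<open>l\<close>, so uniqueness of the second lift carries over to the composite.\<close>
    moreover have "jk_mor_half f h = l"
      if "h \<in> jk_half X" "jk_p X h = v" "jk_mor_half g (jk_mor_half f h) = k" for h
      using that f' fH l_uniq by metis
    ultimately show ?thesis using l(3) by metis
  qed
  then show ?thesis
    unfolding etale_hom_iff[OF X Z] using f' g'
    by (auto simp: compose_def i s fA fH fV cong: conj_cong)
qed

section \<open>Reduced covers are the vertex bijections\<close>

text \<open>Phrased for arcs rather than edges, because arguments about arcs first treat those in
  the image of \<open>jk_s\<close> and then pass to their opposites.\<close>

definition no_isolated_edges :: "('a, 'h, 'v) jk_graph \<Rightarrow> bool" where
  "no_isolated_edges X \<longleftrightarrow> (\<forall>a \<in> jk_arcs X. a \<in> jk_s X ` jk_half X \<or> jk_i X a \<in> jk_s X ` jk_half X)"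

lemma no_isolated_edges_iff: "no_isolated_edges X \<longleftrightarrow> (\<nexists>e. isolated_edge X e)"
  by (auto simp: no_isolated_edges_def isolated_edge_def jk_edges_def)

text \<open>The arcs of deleted half-edges stay and can become isolated edges. This is harmless, as
  members of a covering family may be arbitrary graphs.\<close>

definition delete_vertex :: "('a, 'h, 'v) jk_graph \<Rightarrow> 'v \<Rightarrow> ('a, 'h, 'v) jk_graph" where
  "delete_vertex X w =
     \<lparr>jk_arcs = jk_arcs X, jk_half = {h \<in> jk_half X. jk_p X h \<noteq> w}, jk_verts = jk_verts X - {w},
      jk_s = (\<lambda>h \<in> {h \<in> jk_half X. jk_p X h \<noteq> w}. jk_s X h),
      jk_p = (\<lambda>h \<in> {h \<in> jk_half X. jk_p X h \<noteq> w}. jk_p X h), jk_i = jk_i X\<rparr>"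

text \<open>A vertex that remains keeps all its half-edges, which is what the pullback condition
  demands of an inclusion.\<close>

lemma subgraph_delete_vertex:
  assumes X: "is_jk_graph X"
  shows "subgraph (delete_vertex X w) X"
proof -
  have Z: "is_jk_graph (delete_vertex X w)"
    using X by (auto simp: is_jk_graph_def delete_vertex_def inj_on_def)
  moreover have "jk_id (delete_vertex X w) \<in> etale_hom (delete_vertex X w) X"
    using X unfolding etale_hom_iff[OF Z X]
    by (auto simp: delete_vertex_def is_jk_graph_def)
  ultimately show ?thesis by (simp add: subgraph_def)
qed

text \<open>Meant for \<open>F j\<close> the set of vertices hit by the member \<open>j\<close> of a
  covering family: the member \<open>k\<close> may be shrunk if what it no longer hits is hit
  elsewhere.\<close>

lemma UN_eq_UN_upd:
  assumes "k \<in> K" "A \<subseteq> (\<Union>j \<in> K. F j)" "F k \<subseteq> A \<union> (\<Union>j \<in> K - {k}. F j)"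
  shows "(\<Union>j \<in> K. if j = k then A else F j) = (\<Union>j \<in> K. F j)"
  using assms by (auto split: if_splits)

text \<open>Two distinct vertices with the same image come from members of the family. Deleting one
  of them in its member leaves a covering family, although that member has become a proper subgraph,
  which contradicts reducedness.\<close>

lemma reduced_cover_inj_on_verts:
  assumes Y: "is_jk_graph Y" and X: "is_jk_graph X" and rc: "reduced_cover Y X f"
  shows "inj_on (jk_mor_vert f) (jk_verts Y)"
proof (rule inj_onI, rule ccontr)
  fix v v' assume v: "v \<in> jk_verts Y" "v' \<in> jk_verts Y" "jk_mor_vert f v = jk_mor_vert f v'" "v \<noteq> v'"
  obtain K :: "nat set" and D fam \<iota> where red: "reduced_covering_family X K D fam"
    and sum: "is_sum K D \<iota> Y" and fam: "\<And>k. k \<in> K \<Longrightarrow> jk_comp (D k) Y X f (\<iota> k) = fam k"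
    using rc unfolding reduced_cover_def by blast
  have bij: "bij_betw (\<lambda>(k, v). jk_mor_vert (\<iota> k) v) (SIGMA k:K. jk_verts (D k)) (jk_verts Y)"
    using sum by (simp add: is_sum_def)
  obtain k w where w: "k \<in> K" "w \<in> jk_verts (D k)" "jk_mor_vert (\<iota> k) w = v"
    using v(1) bij_betw_imp_surj_on[OF bij] by force
  obtain k' w' where w': "k' \<in> K" "w' \<in> jk_verts (D k')" "jk_mor_vert (\<iota> k') w' = v'"
    using v(2) bij_betw_imp_surj_on[OF bij] by force
  \<comment> \<open>The members \<open>k\<close> and \<open>k'\<close> may coincide, but then
    \<open>w\<close> and \<open>w'\<close> are distinct; in either case \<open>w'\<close> survives
    the deletion of \<open>w\<close>.\<close>
  have ne: "k' = k \<longrightarrow> w' \<noteq> w" using w w' v by auto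
  have fam_w: "jk_mor_vert (fam k) w = jk_mor_vert (fam k') w'"
    using fam[OF w(1), symmetric] fam[OF w'(1), symmetric] w w' v by (simp add: compose_def)
  have cov: "covering_family X K D fam"
    using red by (simp add: reduced_covering_family_def)
  have Dk: "is_jk_graph (D k)" "fam k \<in> etale_hom (D k) X"
    using cov w(1) by (auto simp: covering_family_def)
  define Z where "Z = delete_vertex (D k) w"
  define z where "z = jk_comp Z (D k) X (fam k) (jk_id Z)"
  have sub: "subgraph Z (D k)" unfolding Z_def by (rule subgraph_delete_vertex[OF Dk(1)])
  then have Z: "is_jk_graph Z" and z: "z \<in> etale_hom Z X"
    using Dk X jk_comp_etale unfolding z_def subgraph_def by blast+
  have "w \<notin> jk_verts Z" by (simp add: Z_def delete_vertex_def)
  then have "Z \<noteq> D k" using w(2) by auto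
  moreover have "covering_family X K (D(k := Z)) (fam(k := z))"
  proof -
    let ?D = "D(k := Z)" and ?fam = "fam(k := z)"
    have edges: "(\<lambda>e. jk_mor_arc (?fam j) ` e) ` jk_edges (?D j)
        = (\<lambda>e. jk_mor_arc (fam j) ` e) ` jk_edges (D j)" for j
    proof (cases "j = k")
      case True
      have "jk_mor_arc z ` e = jk_mor_arc (fam k) ` e" if "e \<in> jk_edges (D k)" for e
      proof (rule image_cong[OF refl])
        fix a assume "a \<in> e"
        then have "a \<in> jk_arcs (D k)" using that Dk(1) by (auto simp: jk_edges_def is_jk_graph_def)
        then show "jk_mor_arc z a = jk_mor_arc (fam k) a"
          by (simp add: z_def Z_def delete_vertex_def compose_def)
      qed
      moreover have "jk_edges Z = jk_edges (D k)"
        by (simp add: Z_def delete_vertex_def jk_edges_def)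
      ultimately show ?thesis using True by simp
    qed simp
    have verts: "jk_mor_vert z ` jk_verts Z = jk_mor_vert (fam k) ` (jk_verts (D k) - {w})"
      by (auto simp: z_def Z_def delete_vertex_def compose_def)
    have "(\<Union>j \<in> K. jk_mor_vert (?fam j) ` jk_verts (?D j))
        = (\<Union>j \<in> K. if j = k then jk_mor_vert (fam k) ` (jk_verts (D k) - {w})
             else jk_mor_vert (fam j) ` jk_verts (D j))"
      using verts by (intro SUP_cong) auto
    also have "\<dots> = (\<Union>j \<in> K. jk_mor_vert (fam j) ` jk_verts (D j))"
    proof (rule UN_eq_UN_upd[OF w(1)])
      \<comment> \<open>Only the image of \<open>w\<close> can be lost, and \<open>w'\<close> has
        the same image: it lies in the rest of member \<open>k\<close> or in another member.\<close>
      show "jk_mor_vert (fam k) ` jk_verts (D k) \<subseteq> jk_mor_vert (fam k) ` (jk_verts (D k) - {w})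
          \<union> (\<Union>j \<in> K - {k}. jk_mor_vert (fam j) ` jk_verts (D j))"
        using fam_w ne w' by (cases "k' = k") auto
    qed (use w(1) in auto)
    finally show ?thesis
      using cov Z z unfolding covering_family_def edges by auto
  qed
  ultimately show False
    using red sub w(1) unfolding reduced_covering_family_def z_def by blast
qed

text \<open>The vertices of the sum are exhausted by the members, so \<open>f\<close> hits exactly
  the vertices that the covering family hits.\<close>

lemma reduced_cover_surj_on_verts:
  assumes rc: "reduced_cover Y X f"
  shows "jk_mor_vert f ` jk_verts Y = jk_verts X"
proof -
  obtain K :: "nat set" and D fam \<iota> where red: "reduced_covering_family X K D fam"
    and sum: "is_sum K D \<iota> Y" and fam: "\<And>k. k \<in> K \<Longrightarrow> jk_comp (D k) Y X f (\<iota> k) = fam k"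
    using rc unfolding reduced_cover_def by blast
  have "bij_betw (\<lambda>(k, v). jk_mor_vert (\<iota> k) v) (SIGMA k:K. jk_verts (D k)) (jk_verts Y)"
    using sum by (simp add: is_sum_def)
  then have "jk_verts Y = (\<lambda>(k, v). jk_mor_vert (\<iota> k) v) ` (SIGMA k:K. jk_verts (D k))"
    by (simp add: bij_betw_def)
  then have "jk_mor_vert f ` jk_verts Y
      = (\<Union>k \<in> K. (\<lambda>v. jk_mor_vert f (jk_mor_vert (\<iota> k) v)) ` jk_verts (D k))"
    by force
  also have "\<dots> = (\<Union>k \<in> K. jk_mor_vert (fam k) ` jk_verts (D k))"
    by (intro SUP_cong refl image_cong) (simp_all add: fam[symmetric] compose_def)
  also have "\<dots> = jk_verts X"
    using red by (simp add: reduced_covering_family_def covering_family_def)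
  finally show ?thesis .
qed

text \<open>The half-edges of \<open>X\<close> are the fibre product of its vertices with the
  half-edges of \<open>Y\<close>, and the pullback of a bijection is a bijection.\<close>

lemma etale_bij_betw_half:
  assumes X: "is_jk_graph X" and Y: "is_jk_graph Y" and f: "f \<in> etale_hom X Y"
    and bij: "bij_betw (jk_mor_vert f) (jk_verts X) (jk_verts Y)"
  shows "bij_betw (jk_mor_half f) (jk_half X) (jk_half Y)"
proof -
  note f' = f[unfolded etale_hom_iff[OF X Y]]
  have pX: "jk_p X h \<in> jk_verts X" if "h \<in> jk_half X" for h
    using X that by (auto simp: is_jk_graph_def)
  have pY: "jk_p Y h \<in> jk_verts Y" if "h \<in> jk_half Y" for h
    using Y that by (auto simp: is_jk_graph_def)
  have "inj_on (jk_mor_half f) (jk_half X)"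
  proof (rule inj_onI)
    fix h h' assume h: "h \<in> jk_half X" "h' \<in> jk_half X" "jk_mor_half f h = jk_mor_half f h'"
    then have "jk_mor_vert f (jk_p X h) = jk_mor_vert f (jk_p X h')" using f' by metis
    then have "jk_p X h = jk_p X h'"
      using h pX bij by (meson bij_betw_imp_inj_on inj_onD)
    moreover have "jk_mor_half f h \<in> jk_half Y" using f' h by auto
    ultimately show "h = h'" using f' h pX by metis
  qed
  moreover have "k \<in> jk_mor_half f ` jk_half X" if k: "k \<in> jk_half Y" for k
  proof -
    obtain v where "v \<in> jk_verts X" "jk_mor_vert f v = jk_p Y k"
      using bij pY[OF k] by (metis bij_betw_imp_surj_on imageE)
    then show ?thesis using f' k by blast
  qed
  moreover have "jk_mor_half f ` jk_half X \<subseteq> jk_half Y" using f' by auto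
  ultimately show ?thesis by (auto simp: bij_betw_def)
qed

text \<open>With all vertices come all half-edges, as the inclusion is etale; with these come their
  arcs and the opposites, and without isolated edges there are no further arcs. This excludes proper
  subgraphs when a cover is shown to be reduced.\<close>

lemma subgraph_eqI:
  assumes Y: "is_jk_graph Y" and noY: "no_isolated_edges Y" and sub: "subgraph Z Y"
    and verts: "jk_verts Z = jk_verts Y"
  shows "Z = Y"
proof -
  have Z: "is_jk_graph Z" and inc: "jk_id Z \<in> etale_hom Z Y"
    using sub by (auto simp: subgraph_def)
  note inc' = inc[unfolded etale_hom_iff[OF Z Y] jk_id_sel]
  \<comment> \<open>Compatibility of the inclusion with the structure maps makes those of
    \<open>Z\<close> restrictions of those of \<open>Y\<close>.\<close>
  have s: "jk_s Z h \<in> jk_arcs Z" "jk_s Y h = jk_s Z h" "jk_p Z h = jk_p Y h" if "h \<in> jk_half Z" for h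
  proof -
    have "jk_p Z h \<in> jk_verts Z" and *: "jk_s Z h \<in> jk_arcs Z"
      using Z that by (auto simp: is_jk_graph_def)
    then show "jk_s Y h = jk_s Z h" "jk_p Z h = jk_p Y h"
      using inc' that by (metis restrict_apply')+
    show "jk_s Z h \<in> jk_arcs Z" by (rule *)
  qed
  have i: "jk_i Z a \<in> jk_arcs Z" "jk_i Z a = jk_i Y a" if "a \<in> jk_arcs Z" for a
  proof -
    show "jk_i Z a \<in> jk_arcs Z" using Z that by (auto simp: is_jk_graph_def)
    then show "jk_i Z a = jk_i Y a" using inc' that by (metis restrict_apply')
  qed
  have "bij_betw (jk_mor_half (jk_id Z)) (jk_half Z) (jk_half Y)"
    by (rule etale_bij_betw_half[OF Z Y inc]) (auto simp: verts bij_betw_def inj_on_def)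
  then have half: "jk_half Z = jk_half Y" by (auto simp: bij_betw_def)
  have "a \<in> jk_arcs Z" if a: "a \<in> jk_arcs Y" for a
  proof -
    have "a \<in> jk_s Y ` jk_half Y \<or> jk_i Y a \<in> jk_s Y ` jk_half Y"
      using noY a by (auto simp: no_isolated_edges_def)
    then have "a \<in> jk_arcs Z \<or> jk_i Y a \<in> jk_arcs Z"
      using s unfolding half[symmetric] by auto
    then show ?thesis using i Y a by (metis is_jk_graph_def)
  qed
  then have arcs: "jk_arcs Z = jk_arcs Y" using inc' by auto
  have "jk_s Z = jk_s Y" "jk_p Z = jk_p Y"
    using Z Y s half by (auto simp: is_jk_graph_def PiE_def intro!: extensionalityI[where A="jk_half Y"])
  moreover have "jk_i Z = jk_i Y"
    using Z Y i arcs by (auto simp: is_jk_graph_def PiE_def intro!: extensionalityI[where A="jk_arcs Y"])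
  ultimately show ?thesis using arcs half verts by simp
qed

text \<open>If \<open>X\<close> has a vertex, \<open>f\<close> alone serves as the covering family,
  with \<open>Y\<close> as the sum of its one member. Dropping that member leaves the vertices
  uncovered, and a proper subgraph of it misses a vertex, whose image nothing else hits.\<close>

lemma bij_on_verts_reduced_cover:
  assumes Y: "is_jk_graph Y" and X: "is_jk_graph X"
    and noY: "no_isolated_edges Y" and noX: "no_isolated_edges X"
    and f: "f \<in> etale_hom Y X" and bij: "bij_betw (jk_mor_vert f) (jk_verts Y) (jk_verts X)"
  shows "reduced_cover Y X f"
proof (cases "jk_verts X = {}")
  \<comment> \<open>The empty graph is covered by the empty family, so there \<open>{f}\<close> is not reduced.\<close>
  case True
  have "jk_verts Y = {}" using bij True by (auto simp: bij_betw_def)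
  have empty: "jk_half G = {} \<and> jk_arcs G = {}"
    if "is_jk_graph G" "no_isolated_edges G" "jk_verts G = {}" for G :: "('a, 'h, 'v) jk_graph"
    using that by (force simp: is_jk_graph_def no_isolated_edges_def)
  have eX: "jk_half X = {}" "jk_arcs X = {}" and eY: "jk_half Y = {}" "jk_arcs Y = {}"
    using empty[OF X noX True] empty[OF Y noY \<open>jk_verts Y = {}\<close>] by auto
  have "reduced_covering_family X ({} :: nat set) D fam" for D fam
    using True eX by (simp add: reduced_covering_family_def covering_family_def jk_edges_def)
  moreover have "is_sum ({} :: nat set) D \<iota> Y" for D \<iota>
    using Y eY \<open>jk_verts Y = {}\<close> by (simp add: is_sum_def bij_betw_def)
  ultimately show ?thesis using f by (force simp: reduced_cover_def)
next
  case False
  note f' = f[unfolded etale_hom_iff[OF Y X]]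
  have half: "bij_betw (jk_mor_half f) (jk_half Y) (jk_half X)"
    by (rule etale_bij_betw_half[OF Y X f bij])
  \<comment> \<open>The covering of edges rests on surjectivity on arcs: first come the arcs of
    half-edges, lifted along the bijection on half-edges, then their opposites.\<close>
  have surj_s: "a \<in> jk_mor_arc f ` jk_arcs Y" if "a \<in> jk_s X ` jk_half X" for a
  proof -
    obtain k where k: "k \<in> jk_half X" "a = jk_s X k" using \<open>a \<in> jk_s X ` jk_half X\<close> by blast
    then obtain h where "h \<in> jk_half Y" "jk_mor_half f h = k"
      using half by (metis bij_betw_imp_surj_on imageE)
    moreover from this have "jk_s Y h \<in> jk_arcs Y" using Y by (auto simp: is_jk_graph_def)
    ultimately show ?thesis using f' k by (metis imageI)
  qed
  have surj: "a \<in> jk_mor_arc f ` jk_arcs Y" if a: "a \<in> jk_arcs X" for a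
  proof (cases "a \<in> jk_s X ` jk_half X")
    case False
    then have "jk_i X a \<in> jk_mor_arc f ` jk_arcs Y"
      using surj_s noX a by (auto simp: no_isolated_edges_def)
    then obtain b where b: "b \<in> jk_arcs Y" "jk_mor_arc f b = jk_i X a" by auto
    then have "jk_mor_arc f (jk_i Y b) = a" using f' X a by (metis is_jk_graph_def)
    moreover have "jk_i Y b \<in> jk_arcs Y" using Y b by (auto simp: is_jk_graph_def)
    ultimately show ?thesis by blast
  qed (use surj_s in blast)
  have "(\<lambda>e. jk_mor_arc f ` e) ` jk_edges Y = jk_edges X"
  proof (intro equalityI subsetI)
    fix e assume "e \<in> (\<lambda>e. jk_mor_arc f ` e) ` jk_edges Y"
    then show "e \<in> jk_edges X" using f' by (auto simp: jk_edges_def)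
  next
    fix e assume "e \<in> jk_edges X"
    then obtain a where "a \<in> jk_arcs X" "e = {a, jk_i X a}" by (auto simp: jk_edges_def)
    moreover from this obtain b where "b \<in> jk_arcs Y" "jk_mor_arc f b = a" using surj by blast
    ultimately have "e = jk_mor_arc f ` {b, jk_i Y b}" "{b, jk_i Y b} \<in> jk_edges Y"
      using f' by (auto simp: jk_edges_def)
    then show "e \<in> (\<lambda>e. jk_mor_arc f ` e) ` jk_edges Y" by blast
  qed
  then have "covering_family X {0 :: nat} (\<lambda>_. Y) (\<lambda>_. f)"
    using f Y bij by (simp add: covering_family_def bij_betw_def)
  \<comment> \<open>Here the case assumption enters: \<open>X\<close> has a vertex, which the empty
    family does not hit.\<close>
  moreover have "\<not> covering_family X ({} :: nat set) D fam" for D fam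
    using False by (auto simp: covering_family_def)
  moreover have "Z = Y" if sub: "subgraph Z Y"
      and cov: "covering_family X {0 :: nat} ((\<lambda>_. Y)(0 := Z)) ((\<lambda>_. f)(0 := jk_comp Z Y X f (jk_id Z)))" for Z
  proof (rule subgraph_eqI[OF Y noY sub])
    have sub_verts: "jk_verts Z \<subseteq> jk_verts Y"
      using sub by (auto simp: subgraph_def etale_hom_def)
    have "jk_mor_vert f ` jk_verts Z = jk_verts X"
      using cov by (auto simp: covering_family_def compose_def)
    then show "jk_verts Z = jk_verts Y"
      using bij sub_verts by (metis bij_betw_def inj_on_image_eq_iff subset_refl)
  qed
  ultimately have "reduced_covering_family X {0 :: nat} (\<lambda>_. Y) (\<lambda>_. f)"
    by (auto simp: reduced_covering_family_def)
  moreover have "is_sum {0 :: nat} (\<lambda>_. Y) (\<lambda>_. jk_id Y) Y"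
    using Y jk_id_etale[OF Y] by (auto simp: is_sum_def bij_betw_def inj_on_def image_iff)
  moreover have "jk_comp Y Y X f (jk_id Y) = f"
  proof -
    have "jk_mor_arc f \<in> extensional (jk_arcs Y)" "jk_mor_half f \<in> extensional (jk_half Y)"
      "jk_mor_vert f \<in> extensional (jk_verts Y)"
      using f' by (auto simp: PiE_def)
    then show ?thesis
      by (intro jk_mor.equality) (auto simp: compose_def fun_eq_iff restrict_def extensional_def)
  qed
  ultimately show ?thesis using f by (auto simp: reduced_cover_def)
qed

section \<open>The hom-sets of the two subcategories\<close>

lemma Gr_rc_sel [simp]:
  "ob Gr_rc = {X. is_jk_graph X \<and> no_isolated_edges X}"
  "idm Gr_rc = jk_id"
  "cmp Gr_rc = jk_comp"
  by (simp_all add: Gr_rc_def subcat_def Gr_def no_isolated_edges_iff)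

text \<open>Without isolated edges, reduced covers are the etale vertex bijections, and these are
  bijective on half-edges. Conversely, two bijections compatible with \<open>jk_p\<close> form a
  pullback square. The arc map need not be injective: two edges with an open end may be sent to a
  single edge.\<close>

lemma hom_Gr_rc_iff:
  assumes "X \<in> ob Gr_rc" "Y \<in> ob Gr_rc"
  shows "f \<in> hom Gr_rc X Y \<longleftrightarrow>
     jk_mor_arc f \<in> jk_arcs X \<rightarrow>\<^sub>E jk_arcs Y \<and>
     jk_mor_half f \<in> extensional (jk_half X) \<and> jk_mor_vert f \<in> extensional (jk_verts X) \<and>
     (\<forall>a \<in> jk_arcs X. jk_mor_arc f (jk_i X a) = jk_i Y (jk_mor_arc f a)) \<and>
     (\<forall>h \<in> jk_half X. jk_mor_arc f (jk_s X h) = jk_s Y (jk_mor_half f h)) \<and>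
     (\<forall>h \<in> jk_half X. jk_mor_vert f (jk_p X h) = jk_p Y (jk_mor_half f h)) \<and>
     bij_betw (jk_mor_half f) (jk_half X) (jk_half Y) \<and>
     bij_betw (jk_mor_vert f) (jk_verts X) (jk_verts Y)"
    (is "?L \<longleftrightarrow> ?R")
proof -
  have X: "is_jk_graph X" "no_isolated_edges X" and Y: "is_jk_graph Y" "no_isolated_edges Y"
    using assms by auto
  have hom: "f \<in> hom Gr_rc X Y \<longleftrightarrow> f \<in> etale_hom X Y \<and> reduced_cover X Y f"
    by (simp add: Gr_rc_def subcat_def Gr_def)
  have p: "jk_p X h \<in> jk_verts X" if "h \<in> jk_half X" for h
    using X that by (auto simp: is_jk_graph_def)
  show ?thesis
  proof
    assume L: ?L
    then have et: "f \<in> etale_hom X Y" and rc: "reduced_cover X Y f" by (auto simp: hom)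
    have bij: "bij_betw (jk_mor_vert f) (jk_verts X) (jk_verts Y)"
      using reduced_cover_inj_on_verts[OF X(1) Y(1) rc] reduced_cover_surj_on_verts[OF rc]
      by (simp add: bij_betw_def)
    show ?R
      using et[unfolded etale_hom_iff[OF X(1) Y(1)]] bij etale_bij_betw_half[OF X(1) Y(1) et bij]
      unfolding PiE_iff by blast
  next
    assume R: ?R
    then have bijH: "bij_betw (jk_mor_half f) (jk_half X) (jk_half Y)"
      and bijV: "bij_betw (jk_mor_vert f) (jk_verts X) (jk_verts Y)"
      and pf: "\<And>h. h \<in> jk_half X \<Longrightarrow> jk_mor_vert f (jk_p X h) = jk_p Y (jk_mor_half f h)"
      by blast+
    \<comment> \<open>The only candidate is the preimage of \<open>k\<close>, and injectivity on
      vertices places it at \<open>v\<close>.\<close>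
    have "\<exists>!h. h \<in> jk_half X \<and> jk_p X h = v \<and> jk_mor_half f h = k"
      if v: "v \<in> jk_verts X" "k \<in> jk_half Y" "jk_mor_vert f v = jk_p Y k" for v k
    proof -
      obtain h where h: "h \<in> jk_half X" "jk_mor_half f h = k"
        using bijH v by (metis bij_betw_imp_surj_on imageE)
      then have "jk_mor_vert f (jk_p X h) = jk_mor_vert f v" using pf v by metis
      then have "jk_p X h = v" using bijV v(1) p[OF h(1)] by (metis bij_betw_imp_inj_on inj_onD)
      moreover have "inj_on (jk_mor_half f) (jk_half X)" using bijH by (simp add: bij_betw_def)
      ultimately show ?thesis using h by (metis inj_onD)
    qed
    moreover have "jk_mor_half f \<in> jk_half X \<rightarrow>\<^sub>E jk_half Y" "jk_mor_vert f \<in> jk_verts X \<rightarrow>\<^sub>E jk_verts Y"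
      using R unfolding PiE_iff bij_betw_def by blast+
    ultimately have "f \<in> etale_hom X Y"
      unfolding etale_hom_iff[OF X(1) Y(1)] using R by blast
    then show ?L using bij_on_verts_reduced_cover[OF X(1) Y(1) X(2) Y(2)] R by (simp add: hom)
  qed
qed

text \<open>Compatibility with \<open>jk_s\<close> forces the values on arcs of half-edges,
  compatibility with \<open>jk_i\<close> those on their opposites; without isolated edges these are
  all arcs. Equations between reduced covers are therefore checked on half-edges and vertices
  only.\<close>

lemma Gr_rc_hom_eqI:
  assumes "X \<in> ob Gr_rc" "Y \<in> ob Gr_rc" and f: "f \<in> hom Gr_rc X Y" and g: "g \<in> hom Gr_rc X Y"
    and half: "\<And>h. h \<in> jk_half X \<Longrightarrow> jk_mor_half f h = jk_mor_half g h"
    and vert: "\<And>v. v \<in> jk_verts X \<Longrightarrow> jk_mor_vert f v = jk_mor_vert g v"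
  shows "f = g"
proof -
  note f' = f[unfolded hom_Gr_rc_iff[OF assms(1,2)]] and g' = g[unfolded hom_Gr_rc_iff[OF assms(1,2)]]
  have X: "is_jk_graph X" "no_isolated_edges X" and Y: "is_jk_graph Y"
    using assms(1,2) by auto
  have s: "jk_mor_arc f a = jk_mor_arc g a" if "a \<in> jk_s X ` jk_half X" for a
    using that f' g' half by auto
  have "jk_mor_arc f a = jk_mor_arc g a" if a: "a \<in> jk_arcs X" for a
  proof (cases "a \<in> jk_s X ` jk_half X")
    case False
    then have "jk_mor_arc f (jk_i X a) = jk_mor_arc g (jk_i X a)"
      using X(2) a by (intro s) (auto simp: no_isolated_edges_def)
    then have "jk_i Y (jk_mor_arc f a) = jk_i Y (jk_mor_arc g a)" using f' g' a by metis
    moreover have "jk_mor_arc f a \<in> jk_arcs Y" "jk_mor_arc g a \<in> jk_arcs Y" using f' g' a by auto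
    ultimately show ?thesis using Y by (metis is_jk_graph_def)
  qed (rule s)
  then have "jk_mor_arc f = jk_mor_arc g" using f' g' by (meson PiE_ext)
  moreover have "jk_mor_half f = jk_mor_half g" "jk_mor_vert f = jk_mor_vert g"
    using f' g' half vert by (meson extensionalityI)+
  ultimately show ?thesis by simp
qed

text \<open>Reduced covers are composed as etale vertex bijections, so that no covering family of
  the composite has to be built from the given ones.\<close>

lemma category_Gr_rc: "category (Gr_rc :: (('a, 'h, 'v) jk_graph, ('a, 'h, 'v) jk_mor) cat)"
proof
  show id: "idm Gr_rc X \<in> hom Gr_rc X X" if "X \<in> ob Gr_rc" for X :: "('a, 'h, 'v) jk_graph"
    using that unfolding hom_Gr_rc_iff[OF that that]
    by (auto simp: is_jk_graph_def bij_betw_def inj_on_def)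
  show comp: "cmp Gr_rc X Y Z g f \<in> hom Gr_rc X Z"
    if "X \<in> ob Gr_rc" "Y \<in> ob Gr_rc" "Z \<in> ob Gr_rc" and f: "f \<in> hom Gr_rc X Y" and g: "g \<in> hom Gr_rc Y Z"
    for X Y Z :: "('a, 'h, 'v) jk_graph" and f g
  proof -
    note f' = f[unfolded hom_Gr_rc_iff[OF that(1,2)]] and g' = g[unfolded hom_Gr_rc_iff[OF that(2,3)]]
    have "jk_comp X Y Z g f \<in> etale_hom X Z"
      using that by (intro jk_comp_etale) (auto simp: Gr_rc_def subcat_def Gr_def)
    moreover have "bij_betw (jk_mor_vert (jk_comp X Y Z g f)) (jk_verts X) (jk_verts Z)"
      using bij_betw_comp_iff[of "jk_mor_vert f" "jk_verts X" "jk_verts Y" "jk_mor_vert g" "jk_verts Z"] f' g'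
      by (simp add: compose_def o_def)
    ultimately show ?thesis
      using that bij_on_verts_reduced_cover[of X Z "jk_comp X Y Z g f"]
      by (auto simp: Gr_rc_def subcat_def Gr_def no_isolated_edges_iff)
  qed
  have half: "jk_mor_half f h \<in> jk_half Y" if "X \<in> ob Gr_rc" "Y \<in> ob Gr_rc" "f \<in> hom Gr_rc X Y" "h \<in> jk_half X"
    for X Y :: "('a, 'h, 'v) jk_graph" and f h
    using that(3,4) unfolding hom_Gr_rc_iff[OF that(1,2)] by (auto simp: bij_betw_def)
  have vert: "jk_mor_vert f h \<in> jk_verts Y" if "X \<in> ob Gr_rc" "Y \<in> ob Gr_rc" "f \<in> hom Gr_rc X Y" "h \<in> jk_verts X"
    for X Y :: "('a, 'h, 'v) jk_graph" and f h
    using that(3,4) unfolding hom_Gr_rc_iff[OF that(1,2)] by (auto simp: bij_betw_def)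
  show "cmp Gr_rc X X Y f (idm Gr_rc X) = f"
    if "X \<in> ob Gr_rc" "Y \<in> ob Gr_rc" "f \<in> hom Gr_rc X Y" for X Y :: "('a, 'h, 'v) jk_graph" and f
    by (rule Gr_rc_hom_eqI[OF that(1,2) comp[OF that(1,1,2) id[OF that(1)] that(3)] that(3)])
       (simp_all add: compose_def)
  show "cmp Gr_rc X Y Y (idm Gr_rc Y) f = f"
    if "X \<in> ob Gr_rc" "Y \<in> ob Gr_rc" "f \<in> hom Gr_rc X Y" for X Y :: "('a, 'h, 'v) jk_graph" and f
    by (rule Gr_rc_hom_eqI[OF that(1,2) comp[OF that(1,2,2,3) id[OF that(2)]] that(3)])
       (simp_all add: compose_def half[OF that] vert[OF that])
  show "cmp Gr_rc W X Z (cmp Gr_rc X Y Z h g) f = cmp Gr_rc W Y Z h (cmp Gr_rc W X Y g f)"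
    if "W \<in> ob Gr_rc" "X \<in> ob Gr_rc" "Y \<in> ob Gr_rc" "Z \<in> ob Gr_rc"
      "f \<in> hom Gr_rc W X" "g \<in> hom Gr_rc X Y" "h \<in> hom Gr_rc Y Z"
    for W X Y Z :: "('a, 'h, 'v) jk_graph" and f g h
    by (rule Gr_rc_hom_eqI[OF that(1,4) comp[OF that(1,2,4,5) comp[OF that(2-4,6,7)]]
          comp[OF that(1,3,4) comp[OF that(1-3,5,6)] that(7)]])
       (simp_all add: compose_def half[OF that(1,2,5)] vert[OF that(1,2,5)])
qed

text \<open>A reduced cover is bijective on half-edges and vertices anyway; only on arcs can it fail
  to be invertible, by joining two edges with an open end into one.\<close>

lemma iso_in_Gr_rcI:
  assumes X: "X \<in> ob Gr_rc" and Y: "Y \<in> ob Gr_rc" and f: "f \<in> hom Gr_rc X Y"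
    and arcs: "bij_betw (jk_mor_arc f) (jk_arcs X) (jk_arcs Y)"
  shows "iso_in Gr_rc X Y f"
proof -
  note f' = f[unfolded hom_Gr_rc_iff[OF X Y]]
  have half: "bij_betw (jk_mor_half f) (jk_half X) (jk_half Y)"
    and vert: "bij_betw (jk_mor_vert f) (jk_verts X) (jk_verts Y)" using f' by auto
  define A where "A = inv_into (jk_arcs X) (jk_mor_arc f)"
  define H where "H = inv_into (jk_half X) (jk_mor_half f)"
  define V where "V = inv_into (jk_verts X) (jk_mor_vert f)"
  define g where "g = \<lparr>jk_mor_arc = restrict A (jk_arcs Y), jk_mor_half = restrict H (jk_half Y),
    jk_mor_vert = restrict V (jk_verts Y)\<rparr>"
  have A: "A b \<in> jk_arcs X" "jk_mor_arc f (A b) = b" if "b \<in> jk_arcs Y" for b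
    using arcs that by (auto simp: A_def bij_betw_def inv_into_into f_inv_into_f)
  have H: "H b \<in> jk_half X" "jk_mor_half f (H b) = b" if "b \<in> jk_half Y" for b
    using half that by (auto simp: H_def bij_betw_def inv_into_into f_inv_into_f)
  have V: "V b \<in> jk_verts X" "jk_mor_vert f (V b) = b" if "b \<in> jk_verts Y" for b
    using vert that by (auto simp: V_def bij_betw_def inv_into_into f_inv_into_f)
  have Af: "A b = a" if "a \<in> jk_arcs X" "jk_mor_arc f a = b" for a b
    using arcs that unfolding A_def by (meson bij_betw_imp_inj_on inv_into_f_eq)
  have Vf: "V b = a" if "a \<in> jk_verts X" "jk_mor_vert f a = b" for a b
    using vert that unfolding V_def by (meson bij_betw_imp_inj_on inv_into_f_eq)
  have Hf: "H b = a" if "a \<in> jk_half X" "jk_mor_half f a = b" for a b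
    using half that unfolding H_def by (meson bij_betw_imp_inj_on inv_into_f_eq)
  have iX: "jk_i X a \<in> jk_arcs X" if "a \<in> jk_arcs X" for a using X that by (auto simp: is_jk_graph_def)
  have sX: "jk_s X h \<in> jk_arcs X" "jk_p X h \<in> jk_verts X" if "h \<in> jk_half X" for h
    using X that by (auto simp: is_jk_graph_def)
  have iY: "jk_i Y a \<in> jk_arcs Y" if "a \<in> jk_arcs Y" for a using Y that by (auto simp: is_jk_graph_def)
  have sY: "jk_s Y h \<in> jk_arcs Y" "jk_p Y h \<in> jk_verts Y" if "h \<in> jk_half Y" for h
    using Y that by (auto simp: is_jk_graph_def)
  \<comment> \<open>A value of an inverse map is identified by its image under \<open>f\<close>, so
    each structure equation for \<open>g\<close> follows from the one for \<open>f\<close>.\<close>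
  have "A (jk_i Y a) = jk_i X (A a)" if "a \<in> jk_arcs Y" for a
    using f' A that iX by (intro Af) auto
  moreover have "A (jk_s Y h) = jk_s X (H h)" "V (jk_p Y h) = jk_p X (H h)" if "h \<in> jk_half Y" for h
    using f' H that sX by (auto intro: Af Vf)
  moreover have "bij_betw H (jk_half Y) (jk_half X)" "bij_betw V (jk_verts Y) (jk_verts X)"
    using half vert by (simp_all add: H_def V_def bij_betw_inv_into)
  ultimately have g: "g \<in> hom Gr_rc Y X"
    unfolding hom_Gr_rc_iff[OF Y X] g_def by (simp add: A iY sY)
  interpret category Gr_rc by (rule category_Gr_rc)
  have fH: "jk_mor_half f h \<in> jk_half Y" if "h \<in> jk_half X" for h
    using half that by (auto simp: bij_betw_def)
  have fV: "jk_mor_vert f v \<in> jk_verts Y" if "v \<in> jk_verts X" for v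
    using vert that by (auto simp: bij_betw_def)
  have "cmp Gr_rc X Y X g f = idm Gr_rc X"
    by (rule Gr_rc_hom_eqI[OF X X cmp_hom[OF X Y X f g] idm_hom[OF X]])
       (simp_all add: g_def compose_def fH fV Hf Vf)
  moreover have "cmp Gr_rc Y X Y f g = idm Gr_rc Y"
    by (rule Gr_rc_hom_eqI[OF Y Y cmp_hom[OF Y X Y g f] idm_hom[OF Y]])
       (simp_all add: g_def compose_def H V)
  ultimately show ?thesis using f g by (auto simp: iso_in_def)
qed

section \<open>The category of graftings\<close>

lemma BM_gr_sel [simp]:
  "ob BM_gr = {\<tau>. is_bm_graph \<tau>}"
  "idm BM_gr = bm_id"
  "cmp BM_gr = bm_comp"
  by (simp_all add: BM_gr_def subcat_def BM_def)

text \<open>A bijective flag map loses no flags, so the involution component is the empty map and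
  the conditions on it are void. What remains of the edge condition is that the flag map commutes
  with the involutions at flags sent to edges of \<tau>. Flags sent to tails are free: two tails of
  \<tau> may become an edge of \<sigma>, which is how graftings join tails.\<close>

lemma hom_BM_gr_iff:
  assumes "\<tau> \<in> ob BM_gr" "\<sigma> \<in> ob BM_gr"
  shows "h \<in> hom BM_gr \<tau> \<sigma> \<longleftrightarrow>
     bm_mor_flag h \<in> extensional (bm_flags \<sigma>) \<and> bm_mor_vert h \<in> extensional (bm_verts \<tau>) \<and>
     bm_mor_inv h = (\<lambda>_. undefined) \<and>
     bij_betw (bm_mor_flag h) (bm_flags \<sigma>) (bm_flags \<tau>) \<and>
     bij_betw (bm_mor_vert h) (bm_verts \<tau>) (bm_verts \<sigma>) \<and>
     (\<forall>f \<in> bm_flags \<sigma>. bm_mor_vert h (bm_bdry \<tau> (bm_mor_flag h f)) = bm_bdry \<sigma> f) \<and>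
     (\<forall>f \<in> bm_flags \<sigma>. bm_inv \<tau> (bm_mor_flag h f) \<noteq> bm_mor_flag h f \<longrightarrow>
        bm_mor_flag h (bm_inv \<sigma> f) = bm_inv \<tau> (bm_mor_flag h f))"
    (is "?L \<longleftrightarrow> ?R")
proof -
  have \<tau>: "bm_inv \<tau> f \<in> bm_flags \<tau>" if "f \<in> bm_flags \<tau>" for f
    using assms that by (auto simp: is_bm_graph_def)
  have \<sigma>: "bm_inv \<sigma> f \<in> bm_flags \<sigma>" "bm_inv \<sigma> (bm_inv \<sigma> f) = f" if "f \<in> bm_flags \<sigma>" for f
    using assms that by (auto simp: is_bm_graph_def)
  have hom: "h \<in> hom BM_gr \<tau> \<sigma> \<longleftrightarrow> h \<in> bm_hom \<tau> \<sigma> \<and> is_grafting \<tau> \<sigma> h"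
    by (simp add: BM_gr_def subcat_def BM_def)
  let ?F = "bm_mor_flag h" and ?g = "inv_into (bm_flags \<sigma>) (bm_mor_flag h)"
  have edges: "(\<forall>e \<in> bm_edges \<tau>. ?g ` e \<in> bm_edges \<sigma>) \<longleftrightarrow>
      (\<forall>f \<in> bm_flags \<sigma>. bm_inv \<tau> (?F f) \<noteq> ?F f \<longrightarrow> ?F (bm_inv \<sigma> f) = bm_inv \<tau> (?F f))"
    if bij: "bij_betw ?F (bm_flags \<sigma>) (bm_flags \<tau>)"
  proof -
    have inj: "inj_on ?F (bm_flags \<sigma>)" using bij by (simp add: bij_betw_def)
    have g: "?g f \<in> bm_flags \<sigma>" "?F (?g f) = f" if "f \<in> bm_flags \<tau>" for f
      using bij that by (auto simp: bij_betw_def inv_into_into f_inv_into_f)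
    have F: "?F f \<in> bm_flags \<tau>" if "f \<in> bm_flags \<sigma>" for f
      using bij that by (auto simp: bij_betw_def)
    \<comment> \<open>An edge through \<open>f\<close> can only be
      \<open>{f, bm_inv \<sigma> f}\<close>, so the edge condition turns into an equation for the
      involution.\<close>
    have edge: "{f, f'} \<in> bm_edges \<sigma> \<longleftrightarrow> f \<in> bm_flags \<sigma> \<and> bm_inv \<sigma> f \<noteq> f \<and> f' = bm_inv \<sigma> f" for f f'
      by (auto simp: bm_edges_def doubleton_eq_iff \<sigma>)
    have "bm_edges \<tau> = (\<lambda>f. {f, bm_inv \<tau> f}) ` {f \<in> bm_flags \<tau>. bm_inv \<tau> f \<noteq> f}"
      by (auto simp: bm_edges_def)
    then have "(\<forall>e \<in> bm_edges \<tau>. ?g ` e \<in> bm_edges \<sigma>) \<longleftrightarrow>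
        (\<forall>f \<in> bm_flags \<tau>. bm_inv \<tau> f \<noteq> f \<longrightarrow> {?g f, ?g (bm_inv \<tau> f)} \<in> bm_edges \<sigma>)"
      by (simp, blast)
    also have "\<dots> \<longleftrightarrow> (\<forall>f \<in> bm_flags \<sigma>. bm_inv \<tau> (?F f) \<noteq> ?F f \<longrightarrow>
        {f, ?g (bm_inv \<tau> (?F f))} \<in> bm_edges \<sigma>)"
      using g F inj by (metis inv_into_f_f)
    also have "\<dots> \<longleftrightarrow> (\<forall>f \<in> bm_flags \<sigma>. bm_inv \<tau> (?F f) \<noteq> ?F f \<longrightarrow>
        ?F (bm_inv \<sigma> f) = bm_inv \<tau> (?F f))"
      unfolding edge using g F inj \<tau> \<sigma> by (metis inv_into_f_f)
    finally show ?thesis .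
  qed
  have sub: "e \<subseteq> bm_flags \<tau>" if "e \<in> bm_edges \<tau>" for e
    using that \<tau> by (auto simp: bm_edges_def)
  define E where "E \<longleftrightarrow> (\<forall>f \<in> bm_flags \<sigma>. bm_inv \<tau> (?F f) \<noteq> ?F f \<longrightarrow>
    ?F (bm_inv \<sigma> f) = bm_inv \<tau> (?F f))"
  show ?thesis
  proof (cases "bij_betw ?F (bm_flags \<sigma>) (bm_flags \<tau>)")
    case bij: True
    then have inj: "inj_on ?F (bm_flags \<sigma>)" and img: "?F ` bm_flags \<sigma> = bm_flags \<tau>"
      and lost: "bm_lost_flags \<tau> \<sigma> h = {}"
      by (auto simp: bm_lost_flags_def bij_betw_def)
    have edges': "(\<forall>e \<in> bm_edges \<tau>. e \<subseteq> bm_flags \<tau> \<longrightarrow> ?g ` e \<in> bm_edges \<sigma>) \<longleftrightarrow> E"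
      unfolding E_def edges[OF bij, symmetric] using sub by blast
    have inv: "bm_inv \<tau> ` bm_flags \<tau> \<subseteq> bm_flags \<tau>" using \<tau> by blast
    have flag: "?F \<in> bm_flags \<sigma> \<rightarrow>\<^sub>E bm_flags \<tau> \<longleftrightarrow> ?F \<in> extensional (bm_flags \<sigma>)"
      using img by (auto simp: PiE_def)
    show ?thesis
      unfolding hom bm_hom_def mem_Collect_eq is_grafting_def lost img edges' flag E_def[symmetric]
      using bij inj inv by (auto simp: PiE_def bij_betw_def)
  next
    case False
    then show ?thesis by (auto simp: hom is_grafting_def)
  qed
qed

text \<open>The involution component of a grafting is the empty map, so it cannot distinguish two
  graftings.\<close>

lemma BM_gr_hom_eqI:
  assumes "\<tau> \<in> ob BM_gr" "\<sigma> \<in> ob BM_gr" "h \<in> hom BM_gr \<tau> \<sigma>" "k \<in> hom BM_gr \<tau> \<sigma>"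
    and "\<And>f. f \<in> bm_flags \<sigma> \<Longrightarrow> bm_mor_flag h f = bm_mor_flag k f"
    and "\<And>v. v \<in> bm_verts \<tau> \<Longrightarrow> bm_mor_vert h v = bm_mor_vert k v"
  shows "h = k"
proof -
  have "bm_mor_flag h = bm_mor_flag k" "bm_mor_vert h = bm_mor_vert k" "bm_mor_inv h = bm_mor_inv k"
    using assms(3-6) unfolding hom_BM_gr_iff[OF assms(1,2)]
    by (meson extensionalityI, meson extensionalityI, simp)
  then show ?thesis by simp
qed

lemma bm_comp_sel [simp]:
  "bm_mor_flag (bm_comp \<tau> \<sigma> \<rho> c g) = compose (bm_flags \<rho>) (bm_mor_flag g) (bm_mor_flag c)"
  "bm_mor_vert (bm_comp \<tau> \<sigma> \<rho> c g) = compose (bm_verts \<tau>) (bm_mor_vert c) (bm_mor_vert g)"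
  by (simp_all add: bm_comp_def)

lemma bm_id_sel [simp]:
  "bm_mor_flag (bm_id \<tau>) = (\<lambda>f \<in> bm_flags \<tau>. f)"
  "bm_mor_vert (bm_id \<tau>) = (\<lambda>v \<in> bm_verts \<tau>. v)"
  "bm_mor_inv (bm_id \<tau>) = (\<lambda>_. undefined)"
  by (simp_all add: bm_id_def)

lemma category_BM_gr: "category (BM_gr :: (('f, 'v) bm_graph, ('f, 'v) bm_mor) cat)"
proof
  have flag: "bm_mor_flag h f \<in> bm_flags \<tau>"
    if "\<tau> \<in> ob BM_gr" "\<sigma> \<in> ob BM_gr" "h \<in> hom BM_gr \<tau> \<sigma>" "f \<in> bm_flags \<sigma>"
    for \<tau> \<sigma> :: "('f, 'v) bm_graph" and h f
    using that(3,4) unfolding hom_BM_gr_iff[OF that(1,2)] by (auto simp: bij_betw_def)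
  have vert: "bm_mor_vert h v \<in> bm_verts \<sigma>"
    if "\<tau> \<in> ob BM_gr" "\<sigma> \<in> ob BM_gr" "h \<in> hom BM_gr \<tau> \<sigma>" "v \<in> bm_verts \<tau>"
    for \<tau> \<sigma> :: "('f, 'v) bm_graph" and h v
    using that(3,4) unfolding hom_BM_gr_iff[OF that(1,2)] by (auto simp: bij_betw_def)
  show id: "idm BM_gr \<tau> \<in> hom BM_gr \<tau> \<tau>" if "\<tau> \<in> ob BM_gr" for \<tau> :: "('f, 'v) bm_graph"
    using that unfolding hom_BM_gr_iff[OF that that]
    by (auto simp: is_bm_graph_def bij_betw_def inj_on_def)
  show comp: "cmp BM_gr \<tau> \<sigma> \<rho> k h \<in> hom BM_gr \<tau> \<rho>"
    if \<tau>: "\<tau> \<in> ob BM_gr" and \<sigma>: "\<sigma> \<in> ob BM_gr" and \<rho>: "\<rho> \<in> ob BM_gr"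
      and h: "h \<in> hom BM_gr \<tau> \<sigma>" and k: "k \<in> hom BM_gr \<sigma> \<rho>"
    for \<tau> \<sigma> \<rho> :: "('f, 'v) bm_graph" and h k
  proof -
    note h' = h[unfolded hom_BM_gr_iff[OF \<tau> \<sigma>]] and k' = k[unfolded hom_BM_gr_iff[OF \<sigma> \<rho>]]
    have bdry: "bm_bdry \<tau> f \<in> bm_verts \<tau>" if "f \<in> bm_flags \<tau>" for f
      using \<tau> that by (auto simp: is_bm_graph_def)
    have inv: "bm_inv \<rho> f \<in> bm_flags \<rho>" if "f \<in> bm_flags \<rho>" for f
      using \<rho> that by (auto simp: is_bm_graph_def)
    have bij: "bij_betw (\<lambda>f. bm_mor_flag h (bm_mor_flag k f)) (bm_flags \<rho>) (bm_flags \<tau>)"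
      "bij_betw (\<lambda>v. bm_mor_vert k (bm_mor_vert h v)) (bm_verts \<tau>) (bm_verts \<rho>)"
      using bij_betw_trans[of "bm_mor_flag k" _ _ "bm_mor_flag h"]
        bij_betw_trans[of "bm_mor_vert h" _ _ "bm_mor_vert k"] h' k' by (auto simp: o_def)
    have "bm_mor_flag h ` bm_mor_flag k ` bm_flags \<rho> = bm_flags \<tau>"
      using h' k' by (simp add: bij_betw_def)
    \<comment> \<open>With no flags lost, the involution of the composite is defined on the empty
      set.\<close>
    then have "bm_mor_inv (bm_comp \<tau> \<sigma> \<rho> k h) = (\<lambda>_. undefined)"
      by (auto simp: bm_comp_def)
    moreover have "bm_mor_flag h (bm_mor_flag k (bm_inv \<rho> f)) = bm_inv \<tau> (bm_mor_flag h (bm_mor_flag k f))"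
      if f: "f \<in> bm_flags \<rho>"
        and ne: "bm_inv \<tau> (bm_mor_flag h (bm_mor_flag k f)) \<noteq> bm_mor_flag h (bm_mor_flag k f)" for f
    proof -
      have eq: "bm_mor_flag h (bm_inv \<sigma> (bm_mor_flag k f)) = bm_inv \<tau> (bm_mor_flag h (bm_mor_flag k f))"
        using h' ne flag[OF \<sigma> \<rho> k f] by blast
      \<comment> \<open>If the composite sends \<open>f\<close> to a flag on an edge of \<tau>, then
        \<open>bm_mor_flag k f\<close> is on an edge of \<sigma>, so the condition for
        \<open>k\<close> applies at \<open>f\<close>.\<close>
      then have "bm_inv \<sigma> (bm_mor_flag k f) \<noteq> bm_mor_flag k f" using ne by auto
      then show ?thesis using eq k' f by metis
    qed
    ultimately show ?thesis
      unfolding hom_BM_gr_iff[OF \<tau> \<rho>] using h' k'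
      by (simp add: compose_def bij bdry inv flag[OF \<tau> \<sigma> h] flag[OF \<sigma> \<rho> k])
  qed
  show "cmp BM_gr \<tau> \<tau> \<sigma> h (idm BM_gr \<tau>) = h"
    if "\<tau> \<in> ob BM_gr" "\<sigma> \<in> ob BM_gr" "h \<in> hom BM_gr \<tau> \<sigma>" for \<tau> \<sigma> :: "('f, 'v) bm_graph" and h
    by (rule BM_gr_hom_eqI[OF that(1,2) comp[OF that(1,1,2) id[OF that(1)] that(3)] that(3)])
       (simp_all add: compose_def flag[OF that])
  show "cmp BM_gr \<tau> \<sigma> \<sigma> (idm BM_gr \<sigma>) h = h"
    if "\<tau> \<in> ob BM_gr" "\<sigma> \<in> ob BM_gr" "h \<in> hom BM_gr \<tau> \<sigma>" for \<tau> \<sigma> :: "('f, 'v) bm_graph" and h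
    by (rule BM_gr_hom_eqI[OF that(1,2) comp[OF that(1,2,2,3) id[OF that(2)]] that(3)])
       (simp_all add: compose_def vert[OF that])
  show "cmp BM_gr \<tau> \<sigma> \<pi> (cmp BM_gr \<sigma> \<rho> \<pi> l k) h = cmp BM_gr \<tau> \<rho> \<pi> l (cmp BM_gr \<tau> \<sigma> \<rho> k h)"
    if "\<tau> \<in> ob BM_gr" "\<sigma> \<in> ob BM_gr" "\<rho> \<in> ob BM_gr" "\<pi> \<in> ob BM_gr"
      "h \<in> hom BM_gr \<tau> \<sigma>" "k \<in> hom BM_gr \<sigma> \<rho>" "l \<in> hom BM_gr \<rho> \<pi>"
    for \<tau> \<sigma> \<rho> \<pi> :: "('f, 'v) bm_graph" and h k l
    by (rule BM_gr_hom_eqI[OF that(1,4) comp[OF that(1,2,4,5) comp[OF that(2-4,6,7)]]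
          comp[OF that(1,3,4) comp[OF that(1-3,5,6)] that(7)]])
       (simp_all add: compose_def flag[OF that(3,4,7)] vert[OF that(1,2,5)])
qed

section \<open>The functor \<open>\<Phi>\<^sub>1\<close> and its quasi-inverse\<close>

lemma Phi1_ob_sel [simp]:
  "jk_arcs (Phi1_ob \<tau>) = bm_flags \<tau> <+> bm_tails \<tau>"
  "jk_half (Phi1_ob \<tau>) = bm_flags \<tau>"
  "jk_verts (Phi1_ob \<tau>) = bm_verts \<tau>"
  "jk_s (Phi1_ob \<tau>) = (\<lambda>f \<in> bm_flags \<tau>. Inl f)"
  "jk_p (Phi1_ob \<tau>) = bm_bdry \<tau>"
  by (simp_all add: Phi1_ob_def)

lemma jk_i_Phi1_ob_Inl:
  "f \<in> bm_flags \<tau> \<Longrightarrow> jk_i (Phi1_ob \<tau>) (Inl f) = (if f \<in> bm_tails \<tau> then Inr f else Inl (bm_inv \<tau> f))"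
  by (auto simp: Phi1_ob_def)

lemma jk_i_Phi1_ob_Inr:
  "f \<in> bm_tails \<tau> \<Longrightarrow> jk_i (Phi1_ob \<tau>) (Inr f) = Inl f"
  by (auto simp: Phi1_ob_def)

text \<open>The involution of arcs has no fixed points, since it exchanges the two arcs over a tail
  and follows \<open>bm_inv \<tau>\<close> elsewhere. Every arc is some \<open>Inl f\<close> or
  opposite to one, so no edge is isolated.\<close>

lemma Phi1_ob_in_Gr_rc:
  assumes "\<tau> \<in> ob BM_gr"
  shows "Phi1_ob \<tau> \<in> ob Gr_rc"
proof -
  have \<tau>: "is_bm_graph \<tau>" using assms by simp
  have j: "bm_inv \<tau> f \<in> bm_flags \<tau>" "bm_inv \<tau> (bm_inv \<tau> f) = f" if "f \<in> bm_flags \<tau>" for f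
    using \<tau> that by (auto simp: is_bm_graph_def)
  have tails: "bm_tails \<tau> \<subseteq> bm_flags \<tau>" by (auto simp: bm_tails_def)
  \<comment> \<open>Non-tails are mapped to non-tails, so the second application of the arc
    involution falls under the same clause as the first.\<close>
  have tail: "bm_inv \<tau> f \<in> bm_tails \<tau> \<longleftrightarrow> f \<in> bm_tails \<tau>" if "f \<in> bm_flags \<tau>" for f
    using j that by (auto simp: bm_tails_def)
  let ?i = "jk_i (Phi1_ob \<tau>)"
  have "?i a \<in> bm_flags \<tau> <+> bm_tails \<tau> \<and> ?i (?i a) = a \<and> ?i a \<noteq> a"
    if a: "a \<in> bm_flags \<tau> <+> bm_tails \<tau>" for a
  proof (cases a)
    case (Inl f)
    then have "f \<in> bm_flags \<tau>" using a by auto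
    then show ?thesis
      using Inl j tail by (auto simp: jk_i_Phi1_ob_Inl jk_i_Phi1_ob_Inr) (auto simp: bm_tails_def)
  next
    case (Inr f)
    then have "f \<in> bm_tails \<tau>" using a by auto
    then show ?thesis using Inr tails by (auto simp: jk_i_Phi1_ob_Inl jk_i_Phi1_ob_Inr)
  qed
  moreover have "?i \<in> extensional (bm_flags \<tau> <+> bm_tails \<tau>)" by (simp add: Phi1_ob_def)
  ultimately have "?i \<in> bm_flags \<tau> <+> bm_tails \<tau> \<rightarrow>\<^sub>E bm_flags \<tau> <+> bm_tails \<tau>"
    and inv: "\<forall>a \<in> bm_flags \<tau> <+> bm_tails \<tau>. ?i (?i a) = a \<and> ?i a \<noteq> a"
    by (auto simp: PiE_def)
  moreover have "finite (bm_tails \<tau>)" using \<tau> tails by (auto simp: is_bm_graph_def finite_subset)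
  ultimately have "is_jk_graph (Phi1_ob \<tau>)"
    using \<tau> by (auto simp: is_jk_graph_def is_bm_graph_def inj_on_def)
  moreover have "no_isolated_edges (Phi1_ob \<tau>)"
    using tails by (auto simp: no_isolated_edges_def jk_i_Phi1_ob_Inr)
  ultimately show ?thesis by simp
qed

lemma Phi1_mor_sel [simp]:
  "jk_mor_arc (Phi1_mor \<tau> \<sigma> h) = (\<lambda>a \<in> bm_flags \<tau> <+> bm_tails \<tau>.
     case a of Inl f \<Rightarrow> Inl (inv_into (bm_flags \<sigma>) (bm_mor_flag h) f)
       | Inr f \<Rightarrow> jk_i (Phi1_ob \<sigma>) (Inl (inv_into (bm_flags \<sigma>) (bm_mor_flag h) f)))"
  "jk_mor_half (Phi1_mor \<tau> \<sigma> h) = restrict (inv_into (bm_flags \<sigma>) (bm_mor_flag h)) (bm_flags \<tau>)"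
  "jk_mor_vert (Phi1_mor \<tau> \<sigma> h) = bm_mor_vert h"
  by (simp_all add: Phi1_mor_def Let_def)

text \<open>The point is compatibility with the arc involutions. Over a tail it holds by the choice
  of the value at \<open>Inr f\<close>; at other flags it is the edge condition of a grafting, read
  for the inverse of the flag map.\<close>

lemma Phi1_mor_in_Gr_rc:
  assumes \<tau>: "\<tau> \<in> ob BM_gr" and \<sigma>: "\<sigma> \<in> ob BM_gr" and h: "h \<in> hom BM_gr \<tau> \<sigma>"
  shows "Phi1_mor \<tau> \<sigma> h \<in> hom Gr_rc (Phi1_ob \<tau>) (Phi1_ob \<sigma>)"
proof -
  note h' = h[unfolded hom_BM_gr_iff[OF \<tau> \<sigma>]]
  note ob\<tau> = Phi1_ob_in_Gr_rc[OF \<tau>] and ob\<sigma> = Phi1_ob_in_Gr_rc[OF \<sigma>]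
  let ?g = "inv_into (bm_flags \<sigma>) (bm_mor_flag h)" and ?arc = "jk_mor_arc (Phi1_mor \<tau> \<sigma> h)"
  have bij: "bij_betw (bm_mor_flag h) (bm_flags \<sigma>) (bm_flags \<tau>)" using h' by blast
  have g: "?g f \<in> bm_flags \<sigma>" "bm_mor_flag h (?g f) = f" if "f \<in> bm_flags \<tau>" for f
    using bij that by (auto simp: bij_betw_def inv_into_into f_inv_into_f)
  have g_eq: "?g f = k" if "k \<in> bm_flags \<sigma>" "bm_mor_flag h k = f" for f k
    using bij that by (meson bij_betw_imp_inj_on inv_into_f_eq)
  have j\<tau>: "bm_inv \<tau> f \<in> bm_flags \<tau>" if "f \<in> bm_flags \<tau>" for f
    using \<tau> that by (auto simp: is_bm_graph_def)
  have j\<sigma>: "bm_inv \<sigma> f \<in> bm_flags \<sigma>" if "f \<in> bm_flags \<sigma>" for f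
    using \<sigma> that by (auto simp: is_bm_graph_def)
  have i\<sigma>: "jk_i (Phi1_ob \<sigma>) a \<in> bm_flags \<sigma> <+> bm_tails \<sigma>" "jk_i (Phi1_ob \<sigma>) (jk_i (Phi1_ob \<sigma>) a) = a"
    if "a \<in> bm_flags \<sigma> <+> bm_tails \<sigma>" for a
    using ob\<sigma> that by (auto simp: is_jk_graph_def)
  have tails: "f \<in> bm_flags \<tau>" if "f \<in> bm_tails \<tau>" for f using that by (simp add: bm_tails_def)
  have arc: "?arc \<in> bm_flags \<tau> <+> bm_tails \<tau> \<rightarrow>\<^sub>E bm_flags \<sigma> <+> bm_tails \<sigma>"
    using g tails by (auto intro!: i\<sigma>)
  have "?arc (jk_i (Phi1_ob \<tau>) a) = jk_i (Phi1_ob \<sigma>) (?arc a)"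
    if a: "a \<in> bm_flags \<tau> <+> bm_tails \<tau>" for a
  proof (cases a)
    case (Inr f)
    then have "f \<in> bm_tails \<tau>" using a by auto
    then show ?thesis using Inr tails g by (simp add: jk_i_Phi1_ob_Inr i\<sigma> InlI InrI)
  next
    case (Inl f)
    then have f: "f \<in> bm_flags \<tau>" using a by auto
    show ?thesis
    proof (cases "f \<in> bm_tails \<tau>")
      case True
      then show ?thesis using Inl f by (simp add: jk_i_Phi1_ob_Inl InlI InrI)
    next
      case False
      then have ne: "bm_inv \<tau> (bm_mor_flag h (?g f)) \<noteq> bm_mor_flag h (?g f)"
        using f g by (simp add: bm_tails_def)
      then have eq: "bm_mor_flag h (bm_inv \<sigma> (?g f)) = bm_inv \<tau> f"
        using h' g[OF f] by metis
      \<comment> \<open>The image of a flag on an edge lies on an edge, so in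
        \<open>Phi1_ob \<sigma>\<close> the opposite of its arc is again an \<open>Inl\<close>
        arc.\<close>
      then have "?g f \<notin> bm_tails \<sigma>" using ne g[OF f] by (auto simp: bm_tails_def)
      moreover have "?g (bm_inv \<tau> f) = bm_inv \<sigma> (?g f)"
        using eq g[OF f] j\<sigma> by (intro g_eq) auto
      ultimately show ?thesis using Inl f False g j\<tau> by (simp add: jk_i_Phi1_ob_Inl InlI)
    qed
  qed
  moreover have "bm_mor_vert h (bm_bdry \<tau> f) = bm_bdry \<sigma> (?g f)" if "f \<in> bm_flags \<tau>" for f
    using h' g[OF that] by metis
  moreover have "bij_betw ?g (bm_flags \<tau>) (bm_flags \<sigma>)" using bij by (rule bij_betw_inv_into)
  ultimately show ?thesis
    unfolding hom_Gr_rc_iff[OF ob\<tau> ob\<sigma>] using arc h' g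
    by (simp add: InlI del: Phi1_mor_sel(1)) (simp add: InlI)
qed

text \<open>The inverse of a composite flag map is the composite of the inverses, and agreement on
  half-edges and vertices suffices for equality of reduced covers.\<close>

lemma functor_Phi1:
  "functor_between (BM_gr :: (('f, 'v) bm_graph, ('f, 'v) bm_mor) cat) Gr_rc Phi1_ob Phi1_mor"
proof -
  interpret C: category BM_gr by (rule category_BM_gr)
  interpret D: category Gr_rc by (rule category_Gr_rc)
  show ?thesis
  proof
    show "Phi1_ob \<tau> \<in> ob Gr_rc" if "\<tau> \<in> ob BM_gr" for \<tau> :: "('f, 'v) bm_graph"
      using that by (rule Phi1_ob_in_Gr_rc)
    show "Phi1_mor \<tau> \<sigma> h \<in> hom Gr_rc (Phi1_ob \<tau>) (Phi1_ob \<sigma>)"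
      if "\<tau> \<in> ob BM_gr" "\<sigma> \<in> ob BM_gr" "h \<in> hom BM_gr \<tau> \<sigma>" for \<tau> \<sigma> :: "('f, 'v) bm_graph" and h
      using that by (rule Phi1_mor_in_Gr_rc)
    show "Phi1_mor \<tau> \<tau> (idm BM_gr \<tau>) = idm Gr_rc (Phi1_ob \<tau>)"
      if \<tau>: "\<tau> \<in> ob BM_gr" for \<tau> :: "('f, 'v) bm_graph"
      by (rule Gr_rc_hom_eqI[OF _ _ Phi1_mor_in_Gr_rc[OF \<tau> \<tau> C.idm_hom[OF \<tau>]] D.idm_hom])
         (use Phi1_ob_in_Gr_rc[OF \<tau>] in \<open>auto intro!: inv_into_f_eq simp: inj_on_def\<close>)
    show "Phi1_mor \<tau> \<rho> (cmp BM_gr \<tau> \<sigma> \<rho> k h)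
        = cmp Gr_rc (Phi1_ob \<tau>) (Phi1_ob \<sigma>) (Phi1_ob \<rho>) (Phi1_mor \<sigma> \<rho> k) (Phi1_mor \<tau> \<sigma> h)"
      if \<tau>: "\<tau> \<in> ob BM_gr" and \<sigma>: "\<sigma> \<in> ob BM_gr" and \<rho>: "\<rho> \<in> ob BM_gr"
        and h: "h \<in> hom BM_gr \<tau> \<sigma>" and k: "k \<in> hom BM_gr \<sigma> \<rho>" for \<tau> \<sigma> \<rho> :: "('f, 'v) bm_graph" and h k
    proof (rule Gr_rc_hom_eqI)
      note ob = Phi1_ob_in_Gr_rc[OF \<tau>] Phi1_ob_in_Gr_rc[OF \<sigma>] Phi1_ob_in_Gr_rc[OF \<rho>]
      show "Phi1_ob \<tau> \<in> ob Gr_rc" "Phi1_ob \<rho> \<in> ob Gr_rc" by (fact ob)+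
      have kh: "cmp BM_gr \<tau> \<sigma> \<rho> k h \<in> hom BM_gr \<tau> \<rho>" by (rule C.cmp_hom[OF \<tau> \<sigma> \<rho> h k])
      then show "Phi1_mor \<tau> \<rho> (cmp BM_gr \<tau> \<sigma> \<rho> k h) \<in> hom Gr_rc (Phi1_ob \<tau>) (Phi1_ob \<rho>)"
        by (rule Phi1_mor_in_Gr_rc[OF \<tau> \<rho>])
      show "cmp Gr_rc (Phi1_ob \<tau>) (Phi1_ob \<sigma>) (Phi1_ob \<rho>) (Phi1_mor \<sigma> \<rho> k) (Phi1_mor \<tau> \<sigma> h)
          \<in> hom Gr_rc (Phi1_ob \<tau>) (Phi1_ob \<rho>)"
        by (rule D.cmp_hom[OF ob Phi1_mor_in_Gr_rc[OF \<tau> \<sigma> h] Phi1_mor_in_Gr_rc[OF \<sigma> \<rho> k]])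
      have bij: "bij_betw (bm_mor_flag h) (bm_flags \<sigma>) (bm_flags \<tau>)"
        "bij_betw (bm_mor_flag k) (bm_flags \<rho>) (bm_flags \<sigma>)"
        "bij_betw (bm_mor_flag (bm_comp \<tau> \<sigma> \<rho> k h)) (bm_flags \<rho>) (bm_flags \<tau>)"
        using h k kh unfolding hom_BM_gr_iff[OF \<tau> \<sigma>] hom_BM_gr_iff[OF \<sigma> \<rho>] hom_BM_gr_iff[OF \<tau> \<rho>] by auto
      show "jk_mor_half (Phi1_mor \<tau> \<rho> (cmp BM_gr \<tau> \<sigma> \<rho> k h)) f
          = jk_mor_half (cmp Gr_rc (Phi1_ob \<tau>) (Phi1_ob \<sigma>) (Phi1_ob \<rho>) (Phi1_mor \<sigma> \<rho> k) (Phi1_mor \<tau> \<sigma> h)) f"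
        if "f \<in> jk_half (Phi1_ob \<tau>)" for f
      proof -
        define f1 where "f1 = inv_into (bm_flags \<sigma>) (bm_mor_flag h) f"
        define f2 where "f2 = inv_into (bm_flags \<rho>) (bm_mor_flag k) f1"
        have f: "f \<in> bm_flags \<tau>" using that by simp
        have f1: "f1 \<in> bm_flags \<sigma>" "bm_mor_flag h f1 = f"
          using bij(1) f by (auto simp: f1_def bij_betw_def inv_into_into f_inv_into_f)
        have f2: "f2 \<in> bm_flags \<rho>" "bm_mor_flag k f2 = f1"
          using bij(2) f1(1) by (auto simp: f2_def bij_betw_def inv_into_into f_inv_into_f)
        have "inv_into (bm_flags \<rho>) (bm_mor_flag (bm_comp \<tau> \<sigma> \<rho> k h)) f = f2"
          by (rule inv_into_f_eq[OF bij_betw_imp_inj_on[OF bij(3)] f2(1)])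
             (simp add: compose_def f1 f2)
        then show ?thesis using f f1 by (simp add: compose_def f1_def[symmetric] f2_def[symmetric])
      qed
      show "jk_mor_vert (Phi1_mor \<tau> \<rho> (cmp BM_gr \<tau> \<sigma> \<rho> k h)) v
          = jk_mor_vert (cmp Gr_rc (Phi1_ob \<tau>) (Phi1_ob \<sigma>) (Phi1_ob \<rho>) (Phi1_mor \<sigma> \<rho> k) (Phi1_mor \<tau> \<sigma> h)) v"
        if "v \<in> jk_verts (Phi1_ob \<tau>)" for v
        using that by (simp add: compose_def)
    qed
  qed
qed

section \<open>The quasi-inverse, which forgets open ends\<close>

definition opposite_half :: "('a, 'h, 'v) jk_graph \<Rightarrow> 'h \<Rightarrow> 'h" where
  "opposite_half X h =
     (if jk_i X (jk_s X h) \<in> jk_s X ` jk_half X then inv_into (jk_half X) (jk_s X) (jk_i X (jk_s X h)) else h)"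

definition Psi1_ob :: "('a, 'h, 'v) jk_graph \<Rightarrow> ('h, 'v) bm_graph" where
  "Psi1_ob X = \<lparr>bm_verts = jk_verts X, bm_flags = jk_half X, bm_bdry = jk_p X,
     bm_inv = restrict (opposite_half X) (jk_half X)\<rparr>"

text \<open>The half-edge map is inverted to become contravariant; a grafting loses no flags, which
  leaves only the empty involution.\<close>

definition Psi1_mor ::
  "('a, 'h, 'v) jk_graph \<Rightarrow> ('a, 'h, 'v) jk_graph \<Rightarrow> ('a, 'h, 'v) jk_mor \<Rightarrow> ('h, 'v) bm_mor" where
  "Psi1_mor X Y k = \<lparr>bm_mor_flag = restrict (inv_into (jk_half X) (jk_mor_half k)) (jk_half Y),
     bm_mor_vert = jk_mor_vert k, bm_mor_inv = (\<lambda>_. undefined)\<rparr>"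

lemma Psi1_ob_sel [simp]:
  "bm_verts (Psi1_ob X) = jk_verts X"
  "bm_flags (Psi1_ob X) = jk_half X"
  "bm_bdry (Psi1_ob X) = jk_p X"
  "bm_inv (Psi1_ob X) = restrict (opposite_half X) (jk_half X)"
  by (simp_all add: Psi1_ob_def)

lemma Psi1_mor_sel [simp]:
  "bm_mor_flag (Psi1_mor X Y k) = restrict (inv_into (jk_half X) (jk_mor_half k)) (jk_half Y)"
  "bm_mor_vert (Psi1_mor X Y k) = jk_mor_vert k"
  "bm_mor_inv (Psi1_mor X Y k) = (\<lambda>_. undefined)"
  by (simp_all add: Psi1_mor_def)

lemma opposite_half_eq:
  assumes "is_jk_graph X" "h' \<in> jk_half X" "jk_i X (jk_s X h) = jk_s X h'"
  shows "opposite_half X h = h'"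
  using assms by (auto simp: opposite_half_def is_jk_graph_def)

text \<open>Either the edge through \<open>h\<close> has an open end, and \<open>h\<close> becomes a
  tail, or it consists of two half-edges, which are distinct because \<open>jk_i\<close> has no
  fixed points.\<close>

lemma opposite_half_cases:
  assumes X: "is_jk_graph X" and h: "h \<in> jk_half X"
  obtains (tail) "jk_i X (jk_s X h) \<notin> jk_s X ` jk_half X" "opposite_half X h = h"
    | (edge) "opposite_half X h \<in> jk_half X" "jk_i X (jk_s X h) = jk_s X (opposite_half X h)"
        "opposite_half X h \<noteq> h"
proof (cases "jk_i X (jk_s X h) \<in> jk_s X ` jk_half X")
  case True
  then obtain h' where h': "h' \<in> jk_half X" "jk_i X (jk_s X h) = jk_s X h'" by blast
  then have "opposite_half X h = h'" by (rule opposite_half_eq[OF X])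
  moreover have "jk_s X h \<in> jk_arcs X" using X h by (auto simp: is_jk_graph_def)
  then have "jk_i X (jk_s X h) \<noteq> jk_s X h" using X by (auto simp: is_jk_graph_def)
  ultimately show ?thesis using h' edge by metis
next
  case False
  then show ?thesis by (intro tail) (simp_all add: opposite_half_def)
qed

lemma opposite_half_opposite_half:
  assumes X: "is_jk_graph X" and h: "h \<in> jk_half X"
  shows "opposite_half X (opposite_half X h) = h"
  using X h
proof (cases rule: opposite_half_cases)
  case edge
  moreover have "jk_s X h \<in> jk_arcs X" using X h by (auto simp: is_jk_graph_def)
  ultimately have "jk_i X (jk_s X (opposite_half X h)) = jk_s X h"
    using X by (metis is_jk_graph_def)
  then show ?thesis by (rule opposite_half_eq[OF X h])
qed simp

lemma Psi1_ob_in_BM_gr: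
  assumes "X \<in> ob Gr_rc"
  shows "Psi1_ob X \<in> ob BM_gr"
proof -
  have X: "is_jk_graph X" using assms by simp
  have "opposite_half X h \<in> jk_half X" if "h \<in> jk_half X" for h
    using X that by (cases rule: opposite_half_cases) (simp_all add: that)
  then show ?thesis
    using X opposite_half_opposite_half[OF X] by (auto simp: is_bm_graph_def is_jk_graph_def)
qed

text \<open>An edge of \<open>X\<close> formed by two half-edges is sent to the edge formed by their
  images, so opposites correspond. A half-edge whose opposite arc is open imposes no condition,
  which matches the freedom of graftings at tails.\<close>

lemma Psi1_mor_in_BM_gr:
  assumes X: "X \<in> ob Gr_rc" and Y: "Y \<in> ob Gr_rc" and k: "k \<in> hom Gr_rc X Y"
  shows "Psi1_mor X Y k \<in> hom BM_gr (Psi1_ob X) (Psi1_ob Y)"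
proof -
  note k' = k[unfolded hom_Gr_rc_iff[OF X Y]]
  have gX: "is_jk_graph X" and gY: "is_jk_graph Y" using X Y by auto
  let ?g = "inv_into (jk_half X) (jk_mor_half k)"
  have bij: "bij_betw (jk_mor_half k) (jk_half X) (jk_half Y)" using k' by blast
  have g: "?g f \<in> jk_half X" "jk_mor_half k (?g f) = f" if "f \<in> jk_half Y" for f
    using bij that by (auto simp: bij_betw_def inv_into_into f_inv_into_f)
  have opp: "opposite_half Y f \<in> jk_half Y \<and> ?g (opposite_half Y f) = opposite_half X (?g f)"
    if f: "f \<in> jk_half Y" and ne: "opposite_half X (?g f) \<noteq> ?g f" for f
    using gX g(1)[OF f]
  proof (cases rule: opposite_half_cases)
    case edge
    let ?o = "opposite_half X (?g f)"
    have "jk_s X (?g f) \<in> jk_arcs X" using gX g(1)[OF f] by (auto simp: is_jk_graph_def)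
    \<comment> \<open>Since \<open>k\<close> commutes with \<open>jk_s\<close> and
      \<open>jk_i\<close>, it sends the opposite of \<open>?g f\<close> to a half-edge whose arc is
      opposite to that of \<open>f\<close>.\<close>
    then have "jk_i Y (jk_s Y f) = jk_s Y (jk_mor_half k ?o)"
      using k' edge g[OF f] by metis
    moreover have o: "jk_mor_half k ?o \<in> jk_half Y" using bij edge by (auto simp: bij_betw_def)
    ultimately have "opposite_half Y f = jk_mor_half k ?o" by (intro opposite_half_eq[OF gY])
    moreover have "?g (jk_mor_half k ?o) = ?o"
      using bij edge by (simp add: bij_betw_def)
    ultimately show ?thesis using o by simp
  qed (use ne in blast)
  have "jk_mor_vert k (jk_p X (?g f)) = jk_p Y f" if "f \<in> jk_half Y" for f
    using k' g[OF that] by metis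
  moreover have "bij_betw ?g (jk_half Y) (jk_half X)" using bij by (rule bij_betw_inv_into)
  ultimately show ?thesis
    unfolding hom_BM_gr_iff[OF Psi1_ob_in_BM_gr[OF X] Psi1_ob_in_BM_gr[OF Y]] using k' opp
    by (simp add: g)
qed

lemma functor_Psi1:
  "functor_between (Gr_rc :: (('a, 'h, 'v) jk_graph, ('a, 'h, 'v) jk_mor) cat) BM_gr Psi1_ob Psi1_mor"
proof -
  interpret C: category BM_gr by (rule category_BM_gr)
  interpret D: category Gr_rc by (rule category_Gr_rc)
  show ?thesis
  proof
    show "Psi1_ob X \<in> ob BM_gr" if "X \<in> ob Gr_rc" for X :: "('a, 'h, 'v) jk_graph"
      using that by (rule Psi1_ob_in_BM_gr)
    show "Psi1_mor X Y f \<in> hom BM_gr (Psi1_ob X) (Psi1_ob Y)"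
      if "X \<in> ob Gr_rc" "Y \<in> ob Gr_rc" "f \<in> hom Gr_rc X Y" for X Y :: "('a, 'h, 'v) jk_graph" and f
      using that by (rule Psi1_mor_in_BM_gr)
    show "Psi1_mor X X (idm Gr_rc X) = idm BM_gr (Psi1_ob X)"
      if X: "X \<in> ob Gr_rc" for X :: "('a, 'h, 'v) jk_graph"
      by (rule BM_gr_hom_eqI[OF _ _ Psi1_mor_in_BM_gr[OF X X D.idm_hom[OF X]] C.idm_hom])
         (use Psi1_ob_in_BM_gr[OF X] in \<open>auto intro!: inv_into_f_eq simp: inj_on_def\<close>)
    show "Psi1_mor X Z (cmp Gr_rc X Y Z g f)
        = cmp BM_gr (Psi1_ob X) (Psi1_ob Y) (Psi1_ob Z) (Psi1_mor Y Z g) (Psi1_mor X Y f)"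
      if X: "X \<in> ob Gr_rc" and Y: "Y \<in> ob Gr_rc" and Z: "Z \<in> ob Gr_rc"
        and f: "f \<in> hom Gr_rc X Y" and g: "g \<in> hom Gr_rc Y Z" for X Y Z :: "('a, 'h, 'v) jk_graph" and f g
    proof (rule BM_gr_hom_eqI)
      note ob = Psi1_ob_in_BM_gr[OF X] Psi1_ob_in_BM_gr[OF Y] Psi1_ob_in_BM_gr[OF Z]
      show "Psi1_ob X \<in> ob BM_gr" "Psi1_ob Z \<in> ob BM_gr" by (fact ob)+
      have gf: "cmp Gr_rc X Y Z g f \<in> hom Gr_rc X Z" by (rule D.cmp_hom[OF X Y Z f g])
      then show "Psi1_mor X Z (cmp Gr_rc X Y Z g f) \<in> hom BM_gr (Psi1_ob X) (Psi1_ob Z)"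
        by (rule Psi1_mor_in_BM_gr[OF X Z])
      show "cmp BM_gr (Psi1_ob X) (Psi1_ob Y) (Psi1_ob Z) (Psi1_mor Y Z g) (Psi1_mor X Y f)
          \<in> hom BM_gr (Psi1_ob X) (Psi1_ob Z)"
        by (rule C.cmp_hom[OF ob Psi1_mor_in_BM_gr[OF X Y f] Psi1_mor_in_BM_gr[OF Y Z g]])
      have bij: "bij_betw (jk_mor_half f) (jk_half X) (jk_half Y)"
        "bij_betw (jk_mor_half g) (jk_half Y) (jk_half Z)"
        "bij_betw (jk_mor_half (jk_comp X Y Z g f)) (jk_half X) (jk_half Z)"
        using f g gf unfolding hom_Gr_rc_iff[OF X Y] hom_Gr_rc_iff[OF Y Z] hom_Gr_rc_iff[OF X Z] by auto
      show "bm_mor_flag (Psi1_mor X Z (cmp Gr_rc X Y Z g f)) h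
          = bm_mor_flag (cmp BM_gr (Psi1_ob X) (Psi1_ob Y) (Psi1_ob Z) (Psi1_mor Y Z g) (Psi1_mor X Y f)) h"
        if "h \<in> bm_flags (Psi1_ob Z)" for h
      proof -
        define h1 where "h1 = inv_into (jk_half Y) (jk_mor_half g) h"
        define h2 where "h2 = inv_into (jk_half X) (jk_mor_half f) h1"
        have h: "h \<in> jk_half Z" using that by simp
        have h1: "h1 \<in> jk_half Y" "jk_mor_half g h1 = h"
          using bij(2) h by (auto simp: h1_def bij_betw_def inv_into_into f_inv_into_f)
        have h2: "h2 \<in> jk_half X" "jk_mor_half f h2 = h1"
          using bij(1) h1(1) by (auto simp: h2_def bij_betw_def inv_into_into f_inv_into_f)
        have "inv_into (jk_half X) (jk_mor_half (jk_comp X Y Z g f)) h = h2"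
          by (rule inv_into_f_eq[OF bij_betw_imp_inj_on[OF bij(3)] h2(1)])
             (simp add: compose_def h1 h2)
        then show ?thesis using h h1 by (simp add: compose_def h1_def[symmetric] h2_def[symmetric])
      qed
      show "bm_mor_vert (Psi1_mor X Z (cmp Gr_rc X Y Z g f)) v
          = bm_mor_vert (cmp BM_gr (Psi1_ob X) (Psi1_ob Y) (Psi1_ob Z) (Psi1_mor Y Z g) (Psi1_mor X Y f)) v"
        if "v \<in> bm_verts (Psi1_ob X)" for v
        using that by (simp add: compose_def)
    qed
  qed
qed

section \<open>The two composites\<close>

lemma Psi1_Phi1_ob:
  assumes "\<tau> \<in> ob BM_gr"
  shows "Psi1_ob (Phi1_ob \<tau>) = \<tau>"
proof -
  have \<tau>: "is_bm_graph \<tau>" and X: "is_jk_graph (Phi1_ob \<tau>)"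
    using assms Phi1_ob_in_Gr_rc[OF assms] by auto
  \<comment> \<open>At a tail the opposite arc \<open>Inr f\<close> is outside the image of
    \<open>jk_s\<close>, so \<open>f\<close> becomes a tail again; at other flags the opposite arc
    is that of \<open>bm_inv \<tau> f\<close>.\<close>
  have "opposite_half (Phi1_ob \<tau>) f = bm_inv \<tau> f" if f: "f \<in> bm_flags \<tau>" for f
  proof (cases "f \<in> bm_tails \<tau>")
    case True
    then show ?thesis using f by (auto simp: opposite_half_def jk_i_Phi1_ob_Inl) (simp add: bm_tails_def)
  next
    case False
    moreover have "bm_inv \<tau> f \<in> bm_flags \<tau>" using \<tau> f by (auto simp: is_bm_graph_def)
    ultimately show ?thesis using f by (intro opposite_half_eq[OF X]) (simp_all add: jk_i_Phi1_ob_Inl)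
  qed
  then have "bm_inv (Psi1_ob (Phi1_ob \<tau>)) = bm_inv \<tau>"
    using \<tau> by (intro extensionalityI[where A="bm_flags \<tau>"]) (auto simp: is_bm_graph_def PiE_def)
  then show ?thesis by simp
qed

text \<open>The flag bijection is inverted twice. Together with the equality on objects, this makes
  the composite the identity functor.\<close>

lemma Psi1_Phi1_mor:
  assumes \<tau>: "\<tau> \<in> ob BM_gr" and \<sigma>: "\<sigma> \<in> ob BM_gr" and h: "h \<in> hom BM_gr \<tau> \<sigma>"
  shows "Psi1_mor (Phi1_ob \<tau>) (Phi1_ob \<sigma>) (Phi1_mor \<tau> \<sigma> h) = h"
proof (rule BM_gr_hom_eqI[OF \<tau> \<sigma> _ h])
  note k = Phi1_mor_in_Gr_rc[OF \<tau> \<sigma> h]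
  note ob = Phi1_ob_in_Gr_rc[OF \<tau>] Phi1_ob_in_Gr_rc[OF \<sigma>]
  show "Psi1_mor (Phi1_ob \<tau>) (Phi1_ob \<sigma>) (Phi1_mor \<tau> \<sigma> h) \<in> hom BM_gr \<tau> \<sigma>"
    using Psi1_mor_in_BM_gr[OF ob k] unfolding Psi1_Phi1_ob[OF \<tau>] Psi1_Phi1_ob[OF \<sigma>] .
  have inj: "inj_on (jk_mor_half (Phi1_mor \<tau> \<sigma> h)) (bm_flags \<tau>)"
    using k unfolding hom_Gr_rc_iff[OF ob] by (simp add: bij_betw_def)
  have bij: "bij_betw (bm_mor_flag h) (bm_flags \<sigma>) (bm_flags \<tau>)"
    using h unfolding hom_BM_gr_iff[OF \<tau> \<sigma>] by blast
  show "bm_mor_flag (Psi1_mor (Phi1_ob \<tau>) (Phi1_ob \<sigma>) (Phi1_mor \<tau> \<sigma> h)) f = bm_mor_flag h f"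
    if f: "f \<in> bm_flags \<sigma>" for f
  proof -
    have "bm_mor_flag h f \<in> bm_flags \<tau>" using bij f by (auto simp: bij_betw_def)
    moreover from this have "jk_mor_half (Phi1_mor \<tau> \<sigma> h) (bm_mor_flag h f) = f"
      using bij f by (simp add: bij_betw_def)
    ultimately have "inv_into (bm_flags \<tau>) (jk_mor_half (Phi1_mor \<tau> \<sigma> h)) f = bm_mor_flag h f"
      by (intro inv_into_f_eq[OF inj])
    then show ?thesis using f by simp
  qed
qed simp

text \<open>Each arc of the rebuilt graph goes to the arc of \<open>X\<close> that it replaces;
  \<open>Inr h\<close> replaces the open end opposite to \<open>h\<close>.\<close>

definition counit1 :: "('h + 'h, 'h, 'v) jk_graph \<Rightarrow> ('h + 'h, 'h, 'v) jk_mor" where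
  "counit1 X = \<lparr>jk_mor_arc = (\<lambda>a \<in> jk_arcs (Phi1_ob (Psi1_ob X)).
       case a of Inl h \<Rightarrow> jk_s X h | Inr h \<Rightarrow> jk_i X (jk_s X h)),
     jk_mor_half = (\<lambda>h \<in> jk_half X. h), jk_mor_vert = (\<lambda>v \<in> jk_verts X. v)\<rparr>"

lemma counit1_sel [simp]:
  "jk_mor_arc (counit1 X) = (\<lambda>a \<in> jk_arcs (Phi1_ob (Psi1_ob X)).
     case a of Inl h \<Rightarrow> jk_s X h | Inr h \<Rightarrow> jk_i X (jk_s X h))"
  "jk_mor_half (counit1 X) = (\<lambda>h \<in> jk_half X. h)"
  "jk_mor_vert (counit1 X) = (\<lambda>v \<in> jk_verts X. v)"
  by (simp_all add: counit1_def)

text \<open>Without isolated edges, the arcs of \<open>X\<close> outside the image of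
  \<open>jk_s\<close> are exactly the opposites of the half-edges that become tails. So
  \<open>Inl\<close> and \<open>Inr\<close> arcs match the two kinds of arcs of \<open>X\<close>,
  and the map on arcs is bijective.\<close>

lemma iso_in_counit1:
  assumes X: "X \<in> ob Gr_rc"
  shows "iso_in Gr_rc (Phi1_ob (Psi1_ob X)) X (counit1 X)"
proof -
  let ?Y = "Phi1_ob (Psi1_ob X)" and ?T = "bm_tails (Psi1_ob X)" and ?c = "jk_mor_arc (counit1 X)"
  have gX: "is_jk_graph X" and noX: "no_isolated_edges X" using X by auto
  have Y: "?Y \<in> ob Gr_rc" by (intro Phi1_ob_in_Gr_rc Psi1_ob_in_BM_gr X)
  have s: "jk_s X h \<in> jk_arcs X" if "h \<in> jk_half X" for h using gX that by (auto simp: is_jk_graph_def)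
  have i: "jk_i X a \<in> jk_arcs X" "jk_i X (jk_i X a) = a" if "a \<in> jk_arcs X" for a
    using gX that by (auto simp: is_jk_graph_def)
  have inj_s: "jk_s X h = jk_s X h' \<longleftrightarrow> h = h'" if "h \<in> jk_half X" "h' \<in> jk_half X" for h h'
    using gX that by (auto simp: is_jk_graph_def inj_on_def)
  have T: "h \<in> ?T \<longleftrightarrow> h \<in> jk_half X \<and> jk_i X (jk_s X h) \<notin> jk_s X ` jk_half X" for h
  proof (cases "h \<in> jk_half X")
    case True
    from gX this show ?thesis
      by (cases rule: opposite_half_cases) (auto simp: bm_tails_def True)
  qed (simp add: bm_tails_def)
  have not_T: "opposite_half X h \<in> jk_half X" "jk_s X (opposite_half X h) = jk_i X (jk_s X h)"
    if h: "h \<in> jk_half X" "h \<notin> ?T" for h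
    using gX h(1) by (cases rule: opposite_half_cases; use h T in auto)+
  have "?c (jk_i ?Y a) = jk_i X (?c a)" if a: "a \<in> jk_half X <+> ?T" for a
  proof (cases a)
    case (Inl h)
    then have h: "h \<in> jk_half X" using a by auto
    then show ?thesis using Inl not_T[OF h] by (auto simp: jk_i_Phi1_ob_Inl InlI InrI)
  next
    case (Inr h)
    then have h: "h \<in> ?T" using a by auto
    then have "h \<in> jk_half X" by (simp add: T)
    then show ?thesis using Inr h s i by (simp add: jk_i_Phi1_ob_Inr InlI InrI)
  qed
  moreover have "?c \<in> jk_half X <+> ?T \<rightarrow>\<^sub>E jk_arcs X"
    using s i by (auto simp: T)
  ultimately have hom: "counit1 X \<in> hom Gr_rc ?Y X"
    unfolding hom_Gr_rc_iff[OF Y X] using gX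
    by (auto simp: is_jk_graph_def bij_betw_def inj_on_def)
  have "inj_on ?c (jk_half X <+> ?T)"
  proof (rule inj_onI)
    fix a b assume ab: "a \<in> jk_half X <+> ?T" "b \<in> jk_half X <+> ?T" "?c a = ?c b"
    show "a = b"
    proof (cases a; cases b)
      fix h h' assume "a = Inl h" "b = Inl h'"
      then show ?thesis using ab inj_s by auto
    next
      fix h h' assume "a = Inl h" "b = Inr h'"
      \<comment> \<open>The arc opposite to a tail is outside the image of \<open>jk_s\<close>, so
        it is not the arc of a half-edge.\<close>
      then show ?thesis using ab T by auto (metis imageI)
    next
      fix h h' assume "a = Inr h" "b = Inl h'"
      then show ?thesis using ab T by auto
    next
      fix h h' assume eq: "a = Inr h" "b = Inr h'"
      then have h: "h \<in> jk_half X" "h' \<in> jk_half X" "jk_i X (jk_s X h) = jk_i X (jk_s X h')"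
        using ab T by auto
      then have "jk_s X h = jk_s X h'" using i s by metis
      then show ?thesis using h inj_s eq by simp
    qed
  qed
  moreover have "a \<in> ?c ` (jk_half X <+> ?T)" if a: "a \<in> jk_arcs X" for a
  proof (cases "a \<in> jk_s X ` jk_half X")
    case True
    then obtain h where "h \<in> jk_half X" "a = jk_s X h" by blast
    then show ?thesis by (intro image_eqI[where x="Inl h"]) auto
  next
    case False
    then obtain h where h: "h \<in> jk_half X" "jk_i X a = jk_s X h"
      using noX a by (auto simp: no_isolated_edges_def)
    then have "a = jk_i X (jk_s X h)" using i a by metis
    moreover from this have "h \<in> ?T" using h False by (simp add: T)
    ultimately show ?thesis by (intro image_eqI[where x="Inr h"]) auto
  qed
  moreover have "?c ` (jk_half X <+> ?T) \<subseteq> jk_arcs X"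
    using s i by (auto simp: T)
  ultimately have "bij_betw ?c (jk_arcs ?Y) (jk_arcs X)" by (auto simp: bij_betw_def)
  then show ?thesis by (rule iso_in_Gr_rcI[OF Y X hom])
qed

section \<open>Generic facts about functors and isomorphisms\<close>

lemma functor_between_id: "category C \<Longrightarrow> functor_between C C (\<lambda>X. X) (\<lambda>X Y f. f)"
  by (simp add: functor_between_def functor_between_axioms_def)

lemma functor_between_comp:
  assumes "functor_between C D Fo Fm" "functor_between D E Go Gm"
  shows "functor_between C E (\<lambda>X. Go (Fo X)) (\<lambda>X Y f. Gm (Fo X) (Fo Y) (Fm X Y f))"
proof -
  interpret F: functor_between C D Fo Fm by fact
  interpret G: functor_between D E Go Gm by fact
  show ?thesis
    by unfold_locales
       (simp_all add: F.functor_ob F.functor_hom F.functor_idm F.functor_cmp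
          G.functor_ob G.functor_hom G.functor_idm G.functor_cmp)
qed

lemma iso_in_idm:
  assumes "category C" "X \<in> ob C"
  shows "iso_in C X X (idm C X)"
proof -
  interpret category C by fact
  show ?thesis using assms(2) by (auto simp: iso_in_def idm_hom cmp_idm intro!: bexI[of _ "idm C X"])
qed

theorem proposition3p6:
  shows "equivalence_of_categories
    (BM_gr :: (('f, 'v) bm_graph, ('f, 'v) bm_mor) cat)
    (Gr_rc :: (('f + 'f, 'f, 'v) jk_graph, ('f + 'f, 'f, 'v) jk_mor) cat)
    Phi1_ob Phi1_mor"
proof -
  let ?BM = "BM_gr :: (('f, 'v) bm_graph, ('f, 'v) bm_mor) cat"
  let ?Gr = "Gr_rc :: (('f + 'f, 'f, 'v) jk_graph, ('f + 'f, 'f, 'v) jk_mor) cat"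
  interpret C: category ?BM by (rule category_BM_gr)
  interpret D: category ?Gr by (rule category_Gr_rc)
  interpret Phi: functor_between ?BM ?Gr Phi1_ob Phi1_mor by (rule functor_Phi1)
  interpret Psi: functor_between ?Gr ?BM Psi1_ob Psi1_mor by (rule functor_Psi1)
  \<comment> \<open>The composite on graftings is the identity functor, so identities serve as the
    unit.\<close>
  have unit: "natural_iso ?BM ?BM (\<lambda>X. X) (\<lambda>X Y f. f) (\<lambda>X. Psi1_ob (Phi1_ob X))
      (\<lambda>X Y f. Psi1_mor (Phi1_ob X) (Phi1_ob Y) (Phi1_mor X Y f)) (idm ?BM)"
    unfolding natural_iso_def
  proof (intro conjI ballI)
    show "functor_between ?BM ?BM (\<lambda>X. X) (\<lambda>X Y f. f)"
      by (rule functor_between_id[OF category_BM_gr])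
    show "functor_between ?BM ?BM (\<lambda>X. Psi1_ob (Phi1_ob X))
        (\<lambda>X Y f. Psi1_mor (Phi1_ob X) (Phi1_ob Y) (Phi1_mor X Y f))"
      by (rule functor_between_comp[OF functor_Phi1 functor_Psi1])
    fix \<tau> :: "('f, 'v) bm_graph" assume \<tau>: "\<tau> \<in> ob BM_gr"
    show "iso_in BM_gr \<tau> (Psi1_ob (Phi1_ob \<tau>)) (idm BM_gr \<tau>)"
      unfolding Psi1_Phi1_ob[OF \<tau>] by (rule iso_in_idm[OF category_BM_gr \<tau>])
    fix \<sigma> h assume \<sigma>: "\<sigma> \<in> ob BM_gr" and h: "h \<in> hom BM_gr \<tau> \<sigma>"
    show "cmp BM_gr \<tau> (Psi1_ob (Phi1_ob \<tau>)) (Psi1_ob (Phi1_ob \<sigma>))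
          (Psi1_mor (Phi1_ob \<tau>) (Phi1_ob \<sigma>) (Phi1_mor \<tau> \<sigma> h)) (idm BM_gr \<tau>)
        = cmp BM_gr \<tau> \<sigma> (Psi1_ob (Phi1_ob \<sigma>)) (idm BM_gr \<sigma>) h"
      unfolding Psi1_Phi1_ob[OF \<tau>] Psi1_Phi1_ob[OF \<sigma>] Psi1_Phi1_mor[OF \<tau> \<sigma> h]
        C.cmp_idm[OF \<tau> \<sigma> h] C.idm_cmp[OF \<tau> \<sigma> h] ..
  qed
  have counit: "natural_iso ?Gr ?Gr (\<lambda>X. Phi1_ob (Psi1_ob X))
      (\<lambda>X Y f. Phi1_mor (Psi1_ob X) (Psi1_ob Y) (Psi1_mor X Y f)) (\<lambda>X. X) (\<lambda>X Y f. f) counit1"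
    unfolding natural_iso_def
  proof (intro conjI ballI)
    show "functor_between ?Gr ?Gr (\<lambda>X. X) (\<lambda>X Y f. f)"
      by (rule functor_between_id[OF category_Gr_rc])
    show "functor_between ?Gr ?Gr (\<lambda>X. Phi1_ob (Psi1_ob X))
        (\<lambda>X Y f. Phi1_mor (Psi1_ob X) (Psi1_ob Y) (Psi1_mor X Y f))"
      by (rule functor_between_comp[OF functor_Psi1 functor_Phi1])
    fix X :: "('f + 'f, 'f, 'v) jk_graph" assume X: "X \<in> ob Gr_rc"
    show "iso_in Gr_rc (Phi1_ob (Psi1_ob X)) X (counit1 X)" by (rule iso_in_counit1[OF X])
    fix Y f assume Y: "Y \<in> ob Gr_rc" and f: "f \<in> hom Gr_rc X Y"
    let ?X' = "Phi1_ob (Psi1_ob X)" and ?Y' = "Phi1_ob (Psi1_ob Y)"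
      and ?f' = "Phi1_mor (Psi1_ob X) (Psi1_ob Y) (Psi1_mor X Y f)"
    have cX: "counit1 X \<in> hom Gr_rc ?X' X" and cY: "counit1 Y \<in> hom Gr_rc ?Y' Y"
      using iso_in_counit1[OF X] iso_in_counit1[OF Y] by (auto simp: iso_in_def)
    note X' = Phi.functor_ob[OF Psi.functor_ob[OF X]] and Y' = Phi.functor_ob[OF Psi.functor_ob[OF Y]]
    note \<psi> = Psi.functor_hom[OF X Y f]
    note f' = Phi.functor_hom[OF Psi.functor_ob[OF X] Psi.functor_ob[OF Y] \<psi>]
    have bij: "bij_betw (jk_mor_half f) (jk_half X) (jk_half Y)"
      using f unfolding hom_Gr_rc_iff[OF X Y] by blast
    have inj: "inj_on (bm_mor_flag (Psi1_mor X Y f)) (jk_half Y)"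
      using \<psi> unfolding hom_BM_gr_iff[OF Psi.functor_ob[OF X] Psi.functor_ob[OF Y]]
      by (simp add: bij_betw_def)
    \<comment> \<open>Inverting a bijection twice returns it, so the composite functor leaves the
      action of \<open>f\<close> on half-edges unchanged.\<close>
    have half: "jk_mor_half f h \<in> jk_half Y"
      "inv_into (jk_half Y) (bm_mor_flag (Psi1_mor X Y f)) h = jk_mor_half f h"
      if h: "h \<in> jk_half X" for h
    proof -
      show *: "jk_mor_half f h \<in> jk_half Y" using bij h by (auto simp: bij_betw_def)
      show "inv_into (jk_half Y) (bm_mor_flag (Psi1_mor X Y f)) h = jk_mor_half f h"
        by (rule inv_into_f_eq[OF inj *]) (use * h bij in \<open>simp add: bij_betw_def\<close>)
    qed
    have vert: "jk_mor_vert f v \<in> jk_verts Y" if "v \<in> jk_verts X" for v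
      using f that unfolding hom_Gr_rc_iff[OF X Y] by (auto simp: bij_betw_def)
    \<comment> \<open>Naturality is checked on half-edges and vertices, where the counit is the
      identity and both sides reduce to \<open>f\<close>.\<close>
    show "cmp Gr_rc ?X' X Y f (counit1 X) = cmp Gr_rc ?X' ?Y' Y (counit1 Y) ?f'"
      by (rule Gr_rc_hom_eqI[OF X' Y D.cmp_hom[OF X' X Y cX f] D.cmp_hom[OF X' Y' Y f' cY]])
         (simp_all add: compose_def half vert del: Psi1_mor_sel(1))
  qed
  show ?thesis
    unfolding equivalence_of_categories_def
    using functor_Phi1 functor_Psi1 unit counit by blast
qed

end
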